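(* Let $X$ be a complex function space (in the sense of the context) and let $Q \in \mathcal{L}(X)$, $Q \neq 0$, be a quasinilpotent operator such that $zQ$ is a positive real operator for some $z \in \mathbb{C}$, $z \neq 0$. If $\mathcal{G}_Q \neq \{0\}$, then $\mathcal{T}_Q = \mathcal{B}_Q^{\circ} \cup \{0\} \subset \mathcal{B}_Q$ and $\mathcal{T}_Q^{1/2} \subset \mathcal{A}_Q$.
   Context: $\mathcal{L}(X)$ is the algebra of bounded linear operators on the complex Banach space $X$; $Q$ is quasinilpotent if $\sigma(Q)=\{0\}$. $A^\circ$ denotes the interior of $A \subset \mathbb{C}$. Complex function space: a complex Banach space $X$ each of whose elements is a function $x:\Omega\to\mathbb{C}$ on a fixed set $\Omega$ (with pointwise vector operations). With $\overline{x}(\omega):=\overline{x(\omega)}$ and $|x|(\omega):=|x(\omega)|$, it is required that: (1) $x\in X \Leftrightarrow \overline{x}\in X$ and $x \in X \Leftrightarrow |x|\in X$; (2) $\|\overline{x}\|=\|\,|x|\,\|=\|x\|$ for all $x\in X$; (3) $\|x\|\le\|y\|$ whenever $x,y \in X$ and $0\le x(\omega)\le y(\omega)$ for all $\omega\in\Omega$. A vector $x\in X$ is real if $x(\omega)\in\mathbb{R}$ for all $\omega$, and positive if $x(\omega)\ge 0$ for all $\omega$. An operator in $\mathcal{L}(X)$ is positive real if it maps positive vectors to positive vectors (hence real vectors to real vectors). Sets: $\mathcal{A}_Q := \{ z \in \mathbb{C} : \limsup_{s\to+\infty}\|(I-szQ)^{-1}\|<\infty\}$; $\mathcal{B}_Q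 := \{ z \in \mathbb{C} : \sup_{j\in\mathbb{N}}\|(I+zQ)^j\|<\infty\}$; $\mathcal{G}_Q := \{ z \in \mathbb{C} : \limsup_{t\to+\infty}\|e^{tzQ}\|<\infty\}$; $\mathcal{T}_Q^{\alpha} := \{ z \in \mathbb{C} : \limsup_{j\to\infty}(j+1)^{\alpha}\|zQ(I+zQ)^j\|<\infty\}$ for $\alpha>0$, and $\mathcal{T}_Q:=\mathcal{T}_Q^1$. *)

theory Defs
  imports "HOL-Analysis.Analysis"
begin

section \<open>Complex Banach spaces\<close>

class complex_normed_vector = real_normed_vector +
  fixes scaleC :: "complex \<Rightarrow> 'a \<Rightarrow> 'a" (infixr "*\<^sub>C" 75)
  assumes scaleC_add_right: "c *\<^sub>C (x + y) = c *\<^sub>C x + c *\<^sub>C y"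
    and scaleC_add_left: "(c + d) *\<^sub>C x = c *\<^sub>C x + d *\<^sub>C x"
    and scaleC_scaleC: "c *\<^sub>C d *\<^sub>C x = (c * d) *\<^sub>C x"
    and scaleC_of_real: "complex_of_real r *\<^sub>C x = scaleR r x"
    and norm_scaleC: "norm (c *\<^sub>C x) = cmod c * norm x"

class complex_banach = complex_normed_vector + complete_space
begin
subclass banach ..
end

lemma scaleC_one [simp]: "1 *\<^sub>C x = (x :: 'a::complex_normed_vector)"
  using scaleC_of_real[of 1 x] by simp

lemma scaleC_zero_right [simp]: "c *\<^sub>C 0 = (0 :: 'a::complex_normed_vector)"
  using scaleC_add_right[of c 0 0] by simp

lemma scaleC_minus_right: "c *\<^sub>C (- x) = - (c *\<^sub>C (x :: 'a::complex_normed_vector))"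
  using scaleC_add_right[of c x "- x"] by (simp add: eq_neg_iff_add_eq_0 add.commute)

lemma scaleC_diff_right: "c *\<^sub>C (x - y) = c *\<^sub>C x - c *\<^sub>C (y :: 'a::complex_normed_vector)"
  using scaleC_add_right[of c x "- y"] by (simp add: scaleC_minus_right)

lemma scaleC_scaleR_commute:
  "c *\<^sub>C (r *\<^sub>R x) = r *\<^sub>R (c *\<^sub>C (x :: 'a::complex_normed_vector))"
  by (metis mult.commute scaleC_of_real scaleC_scaleC)

lemma bounded_linear_scaleC: "bounded_linear (\<lambda>x :: 'a::complex_normed_vector. c *\<^sub>C x)"
  by (rule bounded_linear_intro[where K = "cmod c"])
     (simp_all add: scaleC_add_right scaleC_scaleR_commute norm_scaleC mult.commute)


section \<open>The algebra of bounded operators on a complex normed space\<close>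

text \<open>
  The operator norm is inherited from the real bounded linear maps; it is the same supremum
  over the unit ball for the complex structure.
\<close>

typedef (overloaded) ('a::complex_normed_vector) cop =
  "{T :: 'a \<Rightarrow>\<^sub>L 'a. \<forall>c x. blinfun_apply T (c *\<^sub>C x) = c *\<^sub>C blinfun_apply T x}"
  morphisms blinfun_of_cop Abs_cop
  by (rule exI[of _ 0]) simp

setup_lifting type_definition_cop

lift_definition cop_apply :: "'a::complex_normed_vector cop \<Rightarrow> 'a \<Rightarrow> 'a"
  is blinfun_apply .

instantiation cop :: (complex_normed_vector) real_normed_vector
begin

lift_definition zero_cop :: "'a cop" is 0 by simp
lift_definition plus_cop :: "'a cop \<Rightarrow> 'a cop \<Rightarrow> 'a cop" is "(+)"
  by (simp add: blinfun.add_left scaleC_add_right)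
lift_definition minus_cop :: "'a cop \<Rightarrow> 'a cop \<Rightarrow> 'a cop" is "(-)"
  by (simp add: blinfun.diff_left scaleC_diff_right)
lift_definition uminus_cop :: "'a cop \<Rightarrow> 'a cop" is uminus
  by (simp add: blinfun.minus_left scaleC_minus_right)
lift_definition scaleR_cop :: "real \<Rightarrow> 'a cop \<Rightarrow> 'a cop" is scaleR
  by (simp add: blinfun.scaleR_left scaleC_scaleR_commute)
lift_definition norm_cop :: "'a cop \<Rightarrow> real" is norm .
lift_definition dist_cop :: "'a cop \<Rightarrow> 'a cop \<Rightarrow> real" is dist .
definition sgn_cop :: "'a cop \<Rightarrow> 'a cop" where "sgn_cop T = scaleR (inverse (norm T)) T"
definition [code del]:
  "(uniformity :: ('a cop \<times> 'a cop) filter) = (INF e\<in>{0 <..}. principal {(x, y). dist x y < e})"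
definition open_cop :: "'a cop set \<Rightarrow> bool" where
  [code del]: "open_cop S = (\<forall>x\<in>S. \<forall>\<^sub>F (x', y) in uniformity. x' = x \<longrightarrow> y \<in> S)"

instance
proof
  fix S T U :: "'a cop" and r s :: real
  show "dist S T = norm (S - T)" by transfer (rule dist_norm)
  show "sgn S = inverse (norm S) *\<^sub>R S" by (rule sgn_cop_def)
  show "S + T + U = S + (T + U)" by transfer (rule add.assoc)
  show "S + T = T + S" by transfer (rule add.commute)
  show "0 + S = S" by transfer simp
  show "- S + S = 0" by transfer simp
  show "S - T = S + - T" by transfer simp
  show "r *\<^sub>R (S + T) = r *\<^sub>R S + r *\<^sub>R T" by transfer (rule scaleR_add_right)
  show "(r + s) *\<^sub>R S = r *\<^sub>R S + s *\<^sub>R S" by transfer (rule scaleR_add_left)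
  show "r *\<^sub>R s *\<^sub>R S = (r * s) *\<^sub>R S" by transfer simp
  show "1 *\<^sub>R S = S" by transfer simp
  show "(norm S = 0) = (S = 0)" by transfer simp
  show "norm (S + T) \<le> norm S + norm T" by transfer (rule norm_triangle_ineq)
  show "norm (r *\<^sub>R S) = \<bar>r\<bar> * norm S" by transfer simp
qed (simp_all add: uniformity_cop_def open_cop_def)

end

lemma norm_scaleC_blinfun:
  fixes T :: "'a::complex_normed_vector \<Rightarrow>\<^sub>L 'a"
  shows "norm (blinfun_compose (Blinfun (\<lambda>x. c *\<^sub>C x)) T) = cmod c * norm T"
proof -
  define M where "M d = Blinfun (\<lambda>x :: 'a. d *\<^sub>C x)" for d
  have M: "blinfun_apply (M d) x = d *\<^sub>C x" for d x
    unfolding M_def by (simp add: bounded_linear_Blinfun_apply bounded_linear_scaleC)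
  have le: "norm (M d o\<^sub>L S) \<le> cmod d * norm S" for d and S :: "'a \<Rightarrow>\<^sub>L 'a"
    by (rule norm_blinfun_bound)
       (auto simp: M norm_scaleC mult.assoc intro!: mult_left_mono norm_blinfun)
  show ?thesis
  proof (cases "c = 0")
    case True
    then show ?thesis using le[of c T] by (simp add: M_def)
  next
    case False
    have "M (inverse c) o\<^sub>L (M c o\<^sub>L T) = T"
      by (rule blinfun_eqI) (simp add: M scaleC_scaleC False)
    then have "norm T \<le> cmod (inverse c) * norm (M c o\<^sub>L T)"
      using le[of "inverse c" "M c o\<^sub>L T"] by simp
    then have "cmod c * norm T \<le> norm (M c o\<^sub>L T)"
      using False by (simp add: norm_inverse norm_divide field_simps)
    then show ?thesis using le[of c T] by (simp add: M_def)
  qed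
qed

instantiation cop :: (complex_normed_vector) complex_normed_vector
begin

lift_definition scaleC_cop :: "complex \<Rightarrow> 'a cop \<Rightarrow> 'a cop"
  is "\<lambda>c T. blinfun_compose (Blinfun (\<lambda>x. c *\<^sub>C x)) T"
  by (simp add: bounded_linear_Blinfun_apply bounded_linear_scaleC scaleC_scaleC mult.commute)

instance
proof
  fix S T :: "'a cop" and c d :: complex and r :: real
  note [simp] = bounded_linear_Blinfun_apply bounded_linear_scaleC
  show "c *\<^sub>C (S + T) = c *\<^sub>C S + c *\<^sub>C T"
    by transfer (rule blinfun_eqI, simp add: blinfun.add_left scaleC_add_right)
  show "(c + d) *\<^sub>C S = c *\<^sub>C S + d *\<^sub>C S"
    by transfer (rule blinfun_eqI, simp add: blinfun.add_left scaleC_add_left)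
  show "c *\<^sub>C d *\<^sub>C S = (c * d) *\<^sub>C S"
    by transfer (rule blinfun_eqI, simp add: scaleC_scaleC)
  show "complex_of_real r *\<^sub>C S = r *\<^sub>R S"
    by transfer (rule blinfun_eqI, simp add: blinfun.scaleR_left scaleC_of_real)
  show "norm (c *\<^sub>C S) = cmod c * norm S"
    by transfer (rule norm_scaleC_blinfun)
qed

end

lemma cop_apply_scaleC: "cop_apply (c *\<^sub>C T) x = c *\<^sub>C cop_apply T x"
  by transfer (simp add: bounded_linear_Blinfun_apply bounded_linear_scaleC)

instantiation cop :: (complex_normed_vector) real_normed_algebra
begin

lift_definition times_cop :: "'a cop \<Rightarrow> 'a cop \<Rightarrow> 'a cop" is blinfun_compose
  by simp

instance
proof
  fix S T U :: "'a cop" and r :: real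
  show "S * T * U = S * (T * U)"
    by transfer (rule blinfun_eqI, simp)
  show "(S + T) * U = S * U + T * U"
    by transfer (rule blinfun_eqI, simp add: blinfun.add_left)
  show "S * (T + U) = S * T + S * U"
    by transfer (rule blinfun_eqI, simp add: blinfun.add_left blinfun.add_right)
  show "r *\<^sub>R S * T = r *\<^sub>R (S * T)"
    by transfer (rule blinfun_eqI, simp add: blinfun.scaleR_left)
  show "S * r *\<^sub>R T = r *\<^sub>R (S * T)"
    by transfer (rule blinfun_eqI, simp add: blinfun.scaleR_left blinfun.scaleR_right)
  show "norm (S * T) \<le> norm S * norm T"
    by transfer (rule norm_blinfun_compose)
qed

end

text \<open>
  A complex normed space is of class \<^class>\<open>perfect_space\<close> iff it is not the zero space; this
  is what \<open>norm 1 = 1\<close> requires.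
\<close>

instantiation cop :: ("{complex_normed_vector, perfect_space}") real_normed_algebra_1
begin

lift_definition one_cop :: "'a cop" is id_blinfun by simp

instance
proof
  fix T :: "'a cop"
  show n: "norm (1 :: 'a cop) = 1" by transfer (rule norm_blinfun_id)
  show "1 * T = T" by transfer (rule blinfun_eqI, simp)
  show "T * 1 = T" by transfer (rule blinfun_eqI, simp)
  show "(0 :: 'a cop) \<noteq> 1" using n by (metis norm_zero zero_neq_one)
qed

end

instance cop :: (complex_banach) complex_banach
proof
  fix F :: "nat \<Rightarrow> 'a cop"
  assume "Cauchy F"
  then have "Cauchy (\<lambda>n. blinfun_of_cop (F n))"
    by (simp add: Cauchy_def dist_cop.rep_eq)
  then obtain L where L: "(\<lambda>n. blinfun_of_cop (F n)) \<longlonglongrightarrow> L"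
    using Cauchy_convergent convergent_def by blast
  have "blinfun_apply L (c *\<^sub>C x) = c *\<^sub>C blinfun_apply L x" for c x
  proof (rule LIMSEQ_unique)
    have lim: "(\<lambda>n. blinfun_apply (blinfun_of_cop (F n)) y) \<longlonglongrightarrow> blinfun_apply L y" for y
      using L by (intro tendsto_intros)
    show "(\<lambda>n. blinfun_apply (blinfun_of_cop (F n)) (c *\<^sub>C x)) \<longlonglongrightarrow> blinfun_apply L (c *\<^sub>C x)"
      by (rule lim)
    have "(\<lambda>n. c *\<^sub>C blinfun_apply (blinfun_of_cop (F n)) x) \<longlonglongrightarrow> c *\<^sub>C blinfun_apply L x"
      by (rule bounded_linear.tendsto[OF bounded_linear_scaleC lim])
    then show "(\<lambda>n. blinfun_apply (blinfun_of_cop (F n)) (c *\<^sub>C x)) \<longlonglongrightarrow> c *\<^sub>C blinfun_apply L x"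
      using blinfun_of_cop[of "F _"] by simp
  qed
  then have "blinfun_of_cop (Abs_cop L) = L"
    by (simp add: Abs_cop_inverse)
  with L have "F \<longlonglongrightarrow> Abs_cop L"
    by (simp add: tendsto_iff dist_cop.rep_eq)
  then show "convergent F" by (auto simp: convergent_def)
qed

definition cop_invertible :: "'a::{complex_normed_vector, perfect_space} cop \<Rightarrow> bool" where
  "cop_invertible T \<longleftrightarrow> (\<exists>S. S * T = 1 \<and> T * S = 1)"

text \<open>Only meaningful for invertible operators.\<close>

definition cop_inverse ::
  "'a::{complex_normed_vector, perfect_space} cop \<Rightarrow> 'a cop" where
  "cop_inverse T = (THE S. S * T = 1 \<and> T * S = 1)"

definition cop_spectrum :: "'a::{complex_normed_vector, perfect_space} cop \<Rightarrow> complex set" where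
  "cop_spectrum T = {z. \<not> cop_invertible (z *\<^sub>C 1 - T)}"

definition quasinilpotent :: "'a::{complex_normed_vector, perfect_space} cop \<Rightarrow> bool" where
  "quasinilpotent Q \<longleftrightarrow> cop_spectrum Q = {0}"


section \<open>Complex function spaces\<close>

text \<open>
  A space of functions on the set \<open>\<Omega>\<close> (the type \<open>'w\<close>) is given by a complex Banach space \<open>'a\<close>
  together with the injective map \<open>ev\<close> that returns the function an element is; injectivity and
  the two linearity assumptions let one identify \<open>'a\<close> with the set of functions \<open>range ev\<close>.
  A space of functions on a proper subset of \<open>'w\<close> is covered by extension by zero.
\<close>

locale complex_function_space =
  fixes ev :: "'a::complex_banach \<Rightarrow> 'w \<Rightarrow> complex"
  assumes ev_inj: "inj ev"
    and ev_add: "ev (x + y) w = ev x w + ev y w"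
    and ev_scaleC: "ev (c *\<^sub>C x) w = c * ev x w"
    and cnj_mem_iff: "f \<in> range ev \<longleftrightarrow> (\<lambda>w. cnj (f w)) \<in> range ev"
    and abs_mem_iff: "f \<in> range ev \<longleftrightarrow> (\<lambda>w. complex_of_real (cmod (f w))) \<in> range ev"
    and norm_cnj: "ev y = (\<lambda>w. cnj (ev x w)) \<Longrightarrow> norm y = norm x"
    and norm_abs: "ev y = (\<lambda>w. complex_of_real (cmod (ev x w))) \<Longrightarrow> norm y = norm x"
    and norm_mono: "(\<And>w. ev x w \<in> \<real> \<and> ev y w \<in> \<real> \<and> 0 \<le> Re (ev x w) \<and> Re (ev x w) \<le> Re (ev y w))
      \<Longrightarrow> norm x \<le> norm y"

definition positive_vector :: "('a \<Rightarrow> 'w \<Rightarrow> complex) \<Rightarrow> 'a \<Rightarrow> bool" where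
  "positive_vector ev x \<longleftrightarrow> (\<forall>w. ev x w \<in> \<real> \<and> 0 \<le> Re (ev x w))"

definition positive_real_op ::
  "('a::complex_normed_vector \<Rightarrow> 'w \<Rightarrow> complex) \<Rightarrow> 'a cop \<Rightarrow> bool" where
  "positive_real_op ev T \<longleftrightarrow> (\<forall>x. positive_vector ev x \<longrightarrow> positive_vector ev (cop_apply T x))"


section \<open>The sets of directions\<close>

text \<open>
  For quasinilpotent \<open>Q\<close> the operators \<open>1 - (s * z) *\<^sub>C Q\<close> are all invertible, so the
  inverse below is the actual one.
\<close>

definition A_set :: "'a::{complex_banach, perfect_space} cop \<Rightarrow> complex set" where
  "A_set Q = {z. Limsup at_top (\<lambda>s :: real.
     ereal (norm (cop_inverse (1 - (complex_of_real s * z) *\<^sub>C Q)))) < \<infinity>}"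

definition B_set :: "'a::{complex_banach, perfect_space} cop \<Rightarrow> complex set" where
  "B_set Q = {z. (SUP j :: nat. ereal (norm ((1 + z *\<^sub>C Q) ^ j))) < \<infinity>}"

definition G_set :: "'a::{complex_banach, perfect_space} cop \<Rightarrow> complex set" where
  "G_set Q = {z. Limsup at_top (\<lambda>t :: real.
     ereal (norm (exp ((complex_of_real t * z) *\<^sub>C Q)))) < \<infinity>}"

definition T_set :: "real \<Rightarrow> 'a::{complex_banach, perfect_space} cop \<Rightarrow> complex set" where
  "T_set \<alpha> Q = {z. limsup (\<lambda>j :: nat.
     ereal (real (j + 1) powr \<alpha> * norm (z *\<^sub>C Q * (1 + z *\<^sub>C Q) ^ j))) < \<infinity>}"

end

theory Submission
  imports Defs
begin

text \<open>
  Write \<open>P = z\<^sub>0 Q\<close> for the positive operator. The set \<open>G\<close> of \<open>P\<close> is a convex cone, symmetric under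
  complex conjugation since \<open>P\<close> commutes with it. Hence it contains \<open>1\<close>, \<open>- 1\<close>, or both \<open>\<i>\<close> and \<open>- \<i>\<close>.
  The first is impossible because \<open>exp (t P)\<close> dominates \<open>t P\<close>, the last because a quasinilpotent generator
  of a bounded group vanishes. So \<open>exp (- t P)\<close> is bounded, and the Laplace transform bounds
  \<open>(1 - s z P)\<^sup>-\<^sup>1\<close> for every \<open>z\<close> with \<open>Re z < 0\<close>. If \<open>z\<close> is in the set \<open>T\<close> for exponent \<open>1/2\<close> and
  \<open>Re z \<ge> 0\<close>, then multiplying the estimates for \<open>z\<close> and its conjugate, and discarding positive terms, gives
  \<open>\<parallel>P\<^sup>2\<parallel> \<le> C / j\<close>, so \<open>P\<^sup>2 = 0\<close>, which is incompatible with the boundedness of \<open>exp (- t P) = 1 - t P\<close>.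

  The remaining inclusions need no positivity: a Cauchy estimate in \<open>z\<close> for \<open>(1 + z Q)\<^sup>n\<close> shows that the
  interior of \<open>B\<close> is in \<open>T\<close>. Conversely, if \<open>z\<close> is in \<open>T\<close> and in \<open>A\<close> then \<open>1 + z Q\<close> is power bounded, and
  the binomial expansion of \<open>(1 + z Q + h Q)\<^sup>n\<close> extends this to a neighbourhood of \<open>z\<close>.
\<close>

section \<open>Operators on complex Banach spaces\<close>

lemma cop_apply_simps [simp]:
  shows "cop_apply (S + T) x = cop_apply S x + cop_apply T x"
    and "cop_apply (S - T) x = cop_apply S x - cop_apply T x"
    and "cop_apply 0 x = 0"
    and "cop_apply (r *\<^sub>R T) x = r *\<^sub>R cop_apply T x"
    and "cop_apply (S * T) x = cop_apply S (cop_apply T x)"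
    and "cop_apply T (c *\<^sub>C x) = c *\<^sub>C cop_apply T x"
    and "cop_apply T (x + y) = cop_apply T x + cop_apply T y"
    and "cop_apply T (x - y) = cop_apply T x - cop_apply T y"
  by (transfer, simp add: blinfun.add_left blinfun.diff_left blinfun.scaleR_left
        blinfun.add_right blinfun.diff_right)+

lemma cop_apply_one [simp]: "cop_apply (1 :: 'a::{complex_normed_vector, perfect_space} cop) x = x"
  by transfer simp

lemma cop_eqI: "(\<And>x. cop_apply S x = cop_apply T x) \<Longrightarrow> S = T"
  by transfer (rule blinfun_eqI)

lemma norm_cop_apply: "norm (cop_apply T x) \<le> norm T * norm x"
  by transfer (rule norm_blinfun)

lemma norm_cop_le:
  assumes "0 \<le> C" "\<And>x. norm (cop_apply T x) \<le> C * norm x"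
  shows "norm T \<le> C"
  using assms by transfer (rule norm_blinfun_bound)

lemma bounded_linear_cop_apply: "bounded_linear (\<lambda>T. cop_apply T x)"
  by (rule bounded_linear_intro[where K = "norm x"]) (simp_all add: norm_cop_apply)

text \<open>Supplies the sum rules below and, later, the product rule for a scalar function times an
  operator-valued one.\<close>

lemma bounded_bilinear_scaleC: "bounded_bilinear ((*\<^sub>C) :: complex \<Rightarrow> 'a::complex_normed_vector \<Rightarrow> 'a)"
proof
  fix a b :: complex and x y :: 'a and r :: real
  show "(r *\<^sub>R a) *\<^sub>C x = r *\<^sub>R (a *\<^sub>C x)"
    by (metis scaleC_of_real scaleC_scaleC scaleR_conv_of_real)
  show "\<exists>K. \<forall>a (b::'a). norm (a *\<^sub>C b) \<le> norm a * norm b * K"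
    by (intro exI[of _ 1]) (simp add: norm_scaleC)
qed (simp_all add: scaleC_add_left scaleC_add_right scaleC_scaleR_commute)

lemma scaleC_zero_left [simp]: "0 *\<^sub>C x = (0 :: 'a::complex_normed_vector)"
  using scaleC_of_real[of 0 x] by simp

lemma scaleC_minus_left: "(- c) *\<^sub>C x = - (c *\<^sub>C (x :: 'a::complex_normed_vector))"
  using scaleC_add_left[of c "- c" x] by (simp add: eq_neg_iff_add_eq_0 add.commute)

lemma scaleC_diff_left: "(c - d) *\<^sub>C x = c *\<^sub>C x - d *\<^sub>C (x :: 'a::complex_normed_vector)"
  using scaleC_add_left[of c "- d" x] by (simp add: scaleC_minus_left)

lemma scaleC_of_nat: "of_nat n *\<^sub>C x = real n *\<^sub>R (x :: 'a::complex_normed_vector)"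
  using scaleC_of_real[of "real n" x] by simp

lemma scaleC_sum_left: "(\<Sum>i\<in>A. f i) *\<^sub>C x = (\<Sum>i\<in>A. f i *\<^sub>C (x :: 'a::complex_normed_vector))"
  by (rule bounded_bilinear.sum_left[OF bounded_bilinear_scaleC])

lemma scaleC_sum_right: "c *\<^sub>C (\<Sum>i\<in>A. f i) = (\<Sum>i\<in>A. c *\<^sub>C (f i :: 'a::complex_normed_vector))"
  by (rule bounded_bilinear.sum_right[OF bounded_bilinear_scaleC])

lemma scaleC_mult_left [simp]: "(c *\<^sub>C S) * T = c *\<^sub>C (S * T :: 'a::complex_normed_vector cop)"
  by (rule cop_eqI) (simp add: cop_apply_scaleC)

lemma scaleC_mult_right [simp]: "S * (c *\<^sub>C T) = c *\<^sub>C (S * T :: 'a::complex_normed_vector cop)"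
  by (rule cop_eqI) (simp add: cop_apply_scaleC)

lemma power_scaleC:
  "(c *\<^sub>C T) ^ n = c ^ n *\<^sub>C (T :: 'a::{complex_normed_vector, perfect_space} cop) ^ n"
  by (induction n) (simp_all add: scaleC_scaleC mult.commute)

section \<open>Inverses, and invertibility from quasinilpotence\<close>

lemma cop_inverse_eq:
  assumes "S * T = 1" "T * S = 1"
  shows "cop_inverse T = S"
  unfolding cop_inverse_def
proof (rule the_equality)
  fix S' assume "S' * T = 1 \<and> T * S' = 1"
  then have "S' * (T * S) = S'" "(S' * T) * S = S" using assms by simp_all
  then show "S' = S" by (simp add: mult.assoc)
qed (use assms in simp)

lemma cop_inverse:
  assumes "cop_invertible T"
  shows "cop_inverse T * T = 1" "T * cop_inverse T = 1"
proof -
  obtain S where "S * T = 1" "T * S = 1" using assms by (auto simp: cop_invertible_def)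
  then show "cop_inverse T * T = 1" "T * cop_inverse T = 1" using cop_inverse_eq[of S T] by simp_all
qed

lemma cop_invertible_scaleC:
  assumes "cop_invertible T" "c \<noteq> 0"
  shows "cop_invertible (c *\<^sub>C T)"
proof -
  obtain S where "S * T = 1" "T * S = 1" using assms(1) by (auto simp: cop_invertible_def)
  then have "(inverse c *\<^sub>C S) * (c *\<^sub>C T) = 1 \<and> (c *\<^sub>C T) * (inverse c *\<^sub>C S) = 1"
    using assms(2) by (simp add: scaleC_scaleC)
  then show ?thesis unfolding cop_invertible_def by blast
qed

text \<open>For \<open>w \<noteq> 0\<close> the operator is \<open>w\<close> times
  \<open>inverse w *\<^sub>C 1 - Q\<close>, and \<open>inverse w\<close> lies outside the spectrum.
  From here on quasinilpotence enters only in this form.\<close>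

lemma quasinilpotent_invertible:
  assumes "quasinilpotent Q"
  shows "cop_invertible (1 - w *\<^sub>C Q)"
proof (cases "w = 0")
  case True
  then show ?thesis unfolding cop_invertible_def by (intro exI[of _ 1]) simp
next
  case False
  then have "cop_invertible (inverse w *\<^sub>C 1 - Q)"
  proof -
    have "inverse w \<notin> cop_spectrum Q"
      using assms False by (simp add: quasinilpotent_def)
    then show ?thesis by (simp add: cop_spectrum_def)
  qed
  then have "cop_invertible (w *\<^sub>C (inverse w *\<^sub>C 1 - Q))"
    using False by (rule cop_invertible_scaleC)
  also have "w *\<^sub>C (inverse w *\<^sub>C 1 - Q) = 1 - w *\<^sub>C Q"
    using False by (simp add: scaleC_diff_right scaleC_scaleC)
  finally show ?thesis .
qed

section \<open>The sets of directions in terms of explicit bounds\<close>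

lemma B_set_iff: "z \<in> B_set Q \<longleftrightarrow> (\<exists>M. \<forall>j. norm ((1 + z *\<^sub>C Q) ^ j) \<le> M)"
proof
  assume "z \<in> B_set Q"
  then obtain M where M: "(SUP j :: nat. ereal (norm ((1 + z *\<^sub>C Q) ^ j))) < ereal M"
    unfolding B_set_def mem_Collect_eq by (meson ereal_dense2)
  have "ereal (norm ((1 + z *\<^sub>C Q) ^ j)) \<le> ereal M" for j
    by (rule order_trans[OF SUP_upper less_imp_le[OF M]]) simp
  then show "\<exists>M. \<forall>j. norm ((1 + z *\<^sub>C Q) ^ j) \<le> M" by auto
next
  assume "\<exists>M. \<forall>j. norm ((1 + z *\<^sub>C Q) ^ j) \<le> M"
  then obtain M where M: "\<And>j. norm ((1 + z *\<^sub>C Q) ^ j) \<le> M" by auto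
  have "(SUP j :: nat. ereal (norm ((1 + z *\<^sub>C Q) ^ j))) \<le> ereal M"
    by (rule SUP_least) (simp add: M)
  then show "z \<in> B_set Q" by (auto simp: B_set_def intro: le_less_trans)
qed

lemma Limsup_ereal_less_infinity_iff:
  assumes "F \<noteq> bot"
  shows "Limsup F (\<lambda>x. ereal (f x)) < \<infinity> \<longleftrightarrow> (\<exists>M. \<forall>\<^sub>F x in F. f x \<le> M)"
proof
  assume "Limsup F (\<lambda>x. ereal (f x)) < \<infinity>"
  then obtain M where "Limsup F (\<lambda>x. ereal (f x)) < ereal M"
    by (meson ereal_dense2)
  then have "\<forall>\<^sub>F x in F. ereal (f x) < ereal M" by (rule Limsup_lessD)
  then show "\<exists>M. \<forall>\<^sub>F x in F. f x \<le> M" by (auto intro!: exI[of _ M] elim: eventually_mono)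
next
  assume "\<exists>M. \<forall>\<^sub>F x in F. f x \<le> M"
  then obtain M where "\<forall>\<^sub>F x in F. ereal (f x) \<le> ereal M" by auto
  then have "Limsup F (\<lambda>x. ereal (f x)) \<le> ereal M" by (rule Limsup_bounded)
  then show "Limsup F (\<lambda>x. ereal (f x)) < \<infinity>" by (auto intro: le_less_trans)
qed

text \<open>The upper limit leaves finitely many \<open>j\<close> uncontrolled. Each of them
  contributes a finite value, so one constant serves for all \<open>j\<close>.\<close>

lemma T_set_iff:
  "z \<in> T_set \<alpha> Q \<longleftrightarrow>
     (\<exists>C. \<forall>j. norm (z *\<^sub>C Q * (1 + z *\<^sub>C Q) ^ j) \<le> C / real (j + 1) powr \<alpha>)"
proof -
  let ?f = "\<lambda>j. real (j + 1) powr \<alpha> * norm (z *\<^sub>C Q * (1 + z *\<^sub>C Q) ^ j)"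
  have "z \<in> T_set \<alpha> Q \<longleftrightarrow> (\<exists>M. \<forall>\<^sub>F j in sequentially. ?f j \<le> M)"
    by (simp only: T_set_def mem_Collect_eq Limsup_ereal_less_infinity_iff[OF sequentially_bot])
  also have "\<dots> \<longleftrightarrow> (\<exists>C. \<forall>j. ?f j \<le> C)"
  proof
    assume "\<exists>M. \<forall>\<^sub>F j in sequentially. ?f j \<le> M"
    then obtain M where "\<forall>\<^sub>F j in sequentially. ?f j \<le> M" by blast
    then have "\<forall>\<^sub>F j in sequentially. norm (?f j) \<le> max M 1"
      by (rule eventually_mono) (simp add: max.coboundedI1)
    then have "Bseq ?f" by (intro BfunI)
    then obtain C where "\<And>j. norm (?f j) \<le> C" unfolding Bseq_def by blast
    then show "\<exists>C. \<forall>j. ?f j \<le> C" by (metis abs_le_D1 real_norm_def)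
  next
    assume "\<exists>C. \<forall>j. ?f j \<le> C"
    then show "\<exists>M. \<forall>\<^sub>F j in sequentially. ?f j \<le> M" by (meson always_eventually)
  qed
  also have "\<dots> \<longleftrightarrow> (\<exists>C. \<forall>j. norm (z *\<^sub>C Q * (1 + z *\<^sub>C Q) ^ j) \<le> C / real (j + 1) powr \<alpha>)"
  proof -
    have "?f j \<le> C \<longleftrightarrow> norm (z *\<^sub>C Q * (1 + z *\<^sub>C Q) ^ j) \<le> C / real (j + 1) powr \<alpha>" for j C
      by (subst pos_le_divide_eq, simp only: powr_gt_zero, simp, subst mult.commute, rule refl)
    then show ?thesis by (simp only:)
  qed
  finally show ?thesis .
qed

text \<open>Below the threshold \<open>T\<close> the crude estimate \<open>norm_exp\<close> applies,
  so an eventual bound becomes a bound on the whole half-line.\<close>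

lemma G_set_bounded:
  assumes "z \<in> G_set Q"
  obtains M where "\<And>t. 0 \<le> t \<Longrightarrow> norm (exp (t *\<^sub>R (z *\<^sub>C Q))) \<le> M"
proof -
  have *: "(complex_of_real t * z) *\<^sub>C Q = t *\<^sub>R (z *\<^sub>C Q)" for t
    by (simp add: scaleC_of_real flip: scaleC_scaleC)
  obtain M T where M: "\<And>t. t \<ge> T \<Longrightarrow> norm (exp (t *\<^sub>R (z *\<^sub>C Q))) \<le> M"
    using assms unfolding G_set_def mem_Collect_eq *
      Limsup_ereal_less_infinity_iff[OF trivial_limit_at_top_linorder] eventually_at_top_linorder
    by blast
  have "norm (exp (t *\<^sub>R (z *\<^sub>C Q))) \<le> max M (exp (\<bar>T\<bar> * norm (z *\<^sub>C Q)))" if "0 \<le> t" for t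
  proof (cases "t \<ge> T")
    case False
    have "norm (exp (t *\<^sub>R (z *\<^sub>C Q))) \<le> exp (norm (t *\<^sub>R (z *\<^sub>C Q)))" by (rule norm_exp)
    also have "\<dots> \<le> exp (\<bar>T\<bar> * norm (z *\<^sub>C Q))"
      using that False by (auto intro!: mult_right_mono)
    finally show ?thesis by simp
  qed (use M in \<open>simp add: max.coboundedI1\<close>)
  then show ?thesis by (rule that)
qed

lemma A_set_iff:
  "z \<in> A_set Q \<longleftrightarrow> (\<exists>K s0. \<forall>s\<ge>s0. norm (cop_inverse (1 - s *\<^sub>R (z *\<^sub>C Q))) \<le> K)"
proof -
  have *: "(complex_of_real s * z) *\<^sub>C Q = s *\<^sub>R (z *\<^sub>C Q)" for s
    by (simp add: scaleC_of_real flip: scaleC_scaleC)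
  have "z \<in> A_set Q \<longleftrightarrow> (\<exists>K. \<forall>\<^sub>F s in at_top. norm (cop_inverse (1 - s *\<^sub>R (z *\<^sub>C Q))) \<le> K)"
    by (simp only: A_set_def mem_Collect_eq * Limsup_ereal_less_infinity_iff[OF trivial_limit_at_top_linorder])
  then show ?thesis by (simp only: eventually_at_top_linorder)
qed

lemma G_set_zero: "0 \<in> G_set Q"
  by (simp add: G_set_def Limsup_const)

section \<open>The interior of the set of power boundedness\<close>

lemma power_mult_commuting:
  fixes x y :: "'a::monoid_mult"
  assumes "x * y = y * x"
  shows "(x * y) ^ n = x ^ n * y ^ n"
proof (induction n)
  case (Suc n)
  have "(x * y) ^ Suc n = x * (y * x ^ n) * y ^ n"
    by (simp add: Suc mult.assoc)
  also have "y * x ^ n = x ^ n * y"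
    using power_commuting_commutes[OF assms] by simp
  finally show ?case by (simp add: mult.assoc)
qed simp

text \<open>The induction bounds all products \<open>D ^ n * (S ^ a * T ^ b)\<close> at once:
  absorbing one factor \<open>D\<close> gives a convex combination of two such products with smaller
  \<open>n\<close>, so the constant does not grow.\<close>

lemma norm_power_convex_combination:
  fixes S T :: "'a::real_normed_algebra_1"
  assumes comm: "S * T = T * S"
    and S: "\<And>n. norm (S ^ n) \<le> M" and T: "\<And>n. norm (T ^ n) \<le> N"
    and u: "0 \<le> u" "u \<le> 1"
  shows "norm ((u *\<^sub>R S + (1 - u) *\<^sub>R T) ^ n) \<le> M * N"
proof -
  define D where "D = u *\<^sub>R S + (1 - u) *\<^sub>R T"
  have "norm (D ^ n * (S ^ a * T ^ b)) \<le> M * N" for a b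
  proof (induction n arbitrary: a b)
    case 0
    have "norm (S ^ a * T ^ b) \<le> norm (S ^ a) * norm (T ^ b)" by (rule norm_mult_ineq)
    also have "\<dots> \<le> M * N"
      using S[of a] T[of b] order_trans[OF norm_ge_zero S[of a]] by (intro mult_mono) auto
    finally show ?case by simp
  next
    case (Suc n)
    have "T * S ^ a = S ^ a * T"
      using power_commuting_commutes[OF comm] by simp
    then have "D * (S ^ a * T ^ b) = u *\<^sub>R (S ^ Suc a * T ^ b) + (1 - u) *\<^sub>R (S ^ a * T ^ Suc b)"
      by (simp add: D_def distrib_right mult.assoc flip: mult.assoc[of T])
    then have "D ^ Suc n * (S ^ a * T ^ b)
        = u *\<^sub>R (D ^ n * (S ^ Suc a * T ^ b)) + (1 - u) *\<^sub>R (D ^ n * (S ^ a * T ^ Suc b))"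
      by (simp only: power_Suc2 mult.assoc distrib_left mult_scaleR_right)
    then have "norm (D ^ Suc n * (S ^ a * T ^ b))
        \<le> u * norm (D ^ n * (S ^ Suc a * T ^ b)) + (1 - u) * norm (D ^ n * (S ^ a * T ^ Suc b))"
      using u norm_triangle_ineq by (metis abs_of_nonneg diff_ge_0_iff_ge norm_scaleR)
    also have "\<dots> \<le> u * (M * N) + (1 - u) * (M * N)"
      using u by (intro add_mono mult_left_mono Suc.IH) auto
    finally show ?case by (simp add: algebra_simps)
  qed
  from this[of 0 0] show ?thesis by (simp add: D_def)
qed

text \<open>If \<open>N\<close> does not divide \<open>k\<close>, multiplication by the primitive
  root \<open>w\<close> permutes the roots and multiplies the sum by \<open>w ^ k\<close>, which is
  not 1. Such sums take the place of Cauchy integrals over circles.\<close>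

lemma sum_powers_roots_unity:
  assumes "N > 0"
  shows "(\<Sum>z | z ^ N = 1. z ^ k) = (if N dvd k then of_nat N else (0::complex))"
proof (cases "N dvd k")
  case True
  then obtain m where "k = N * m" by (auto elim: dvdE)
  then have "(\<Sum>z::complex | z ^ N = 1. z ^ k) = (\<Sum>z::complex | z ^ N = 1. 1)"
    by (intro sum.cong) (auto simp: power_mult)
  then show ?thesis using True card_roots_unity_eq[OF assms] by simp
next
  case False
  define w where "w = exp (2 * of_real pi * \<i> * of_nat 1 / of_nat N)"
  have wk: "w ^ j = exp (2 * of_real pi * \<i> * of_nat j / of_nat N)" for j
    unfolding w_def exp_of_nat_mult[symmetric] by (simp add: field_simps)
  have wN: "w ^ N = 1" and wk1: "w ^ k \<noteq> 1"
    unfolding wk using assms False complex_root_unity_eq_1[of N] by auto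
  have "bij_betw ((*) w) {z. z ^ N = 1} {z. z ^ N = 1}"
    using wN by (intro bij_betw_byWitness[where f' = "\<lambda>z. z / w"])
      (auto simp: power_mult_distrib power_divide assms zero_power)
  then have "(\<Sum>z | z ^ N = 1. (w * z) ^ k) = (\<Sum>z | z ^ N = 1. z ^ k)"
    by (rule sum.reindex_bij_betw)
  then have "w ^ k * (\<Sum>z | z ^ N = 1. z ^ k) = (\<Sum>z | z ^ N = 1. z ^ k)"
    by (simp add: power_mult_distrib sum_distrib_left)
  then show ?thesis using wk1 False by simp
qed

text \<open>\<open>exp_series_add_commuting\<close> is the same expansion divided by
  \<open>fact n\<close>, for commuting elements of a noncommutative algebra.\<close>

lemma binomial_commuting_scaleC:
  fixes S X :: "'a::{complex_banach, perfect_space} cop"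
  assumes "X * S = S * X"
  shows "(S + c *\<^sub>C X) ^ n = (\<Sum>k\<le>n. (of_nat (n choose k) * c ^ k) *\<^sub>C (X ^ k * S ^ (n - k)))"
proof -
  have "(c *\<^sub>C X + S) ^ n /\<^sub>R fact n
      = (\<Sum>k\<le>n. (c *\<^sub>C X) ^ k /\<^sub>R fact k * (S ^ (n - k) /\<^sub>R fact (n - k)))"
    by (rule exp_series_add_commuting) (simp add: assms)
  then have "fact n *\<^sub>R ((c *\<^sub>C X + S) ^ n /\<^sub>R fact n)
      = (\<Sum>k\<le>n. fact n *\<^sub>R ((c *\<^sub>C X) ^ k /\<^sub>R fact k * (S ^ (n - k) /\<^sub>R fact (n - k))))"
    by (simp only: scaleR_sum_right)
  also have "\<dots> = (\<Sum>k\<le>n. (of_nat (n choose k) * c ^ k) *\<^sub>C (X ^ k * S ^ (n - k)))"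
  proof (rule sum.cong[OF refl])
    fix k assume "k \<in> {..n}"
    then have b: "real (n choose k) = fact n / (fact k * fact (n - k))"
      by (simp add: binomial_fact)
    have "(of_nat (n choose k) * c ^ k) *\<^sub>C (X ^ k * S ^ (n - k))
        = real (n choose k) *\<^sub>R c ^ k *\<^sub>C (X ^ k * S ^ (n - k))"
      by (simp add: scaleC_of_nat flip: scaleC_scaleC)
    then show "fact n *\<^sub>R ((c *\<^sub>C X) ^ k /\<^sub>R fact k * (S ^ (n - k) /\<^sub>R fact (n - k)))
        = (of_nat (n choose k) * c ^ k) *\<^sub>C (X ^ k * S ^ (n - k))"
      by (simp add: b power_scaleC divide_inverse mult.commute mult.left_commute)
  qed
  finally show ?thesis by (simp add: add.commute)
qed

text \<open>Convexity of \<open>B_set\<close> with explicit constants: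
  \<open>1 + w *\<^sub>C Q\<close> is affine in \<open>w\<close>.\<close>

lemma power_bounded_segment:
  fixes Q :: "'a::{complex_banach, perfect_space} cop"
  assumes p: "\<And>n. norm ((1 + p *\<^sub>C Q) ^ n) \<le> M" and q: "\<And>n. norm ((1 + q *\<^sub>C Q) ^ n) \<le> N"
    and u: "0 \<le> u" "u \<le> 1" and w: "w = of_real u * p + of_real (1 - u) * q"
  shows "norm ((1 + w *\<^sub>C Q) ^ n) \<le> M * N"
proof -
  have "1 + w *\<^sub>C Q = u *\<^sub>R (1 + p *\<^sub>C Q) + (1 - u) *\<^sub>R (1 + q *\<^sub>C Q)"
    unfolding w scaleC_add_left scaleC_scaleC[symmetric] scaleC_of_real
    by (simp add: algebra_simps)
  moreover have "(1 + p *\<^sub>C Q) * (1 + q *\<^sub>C Q) = (1 + q *\<^sub>C Q) * (1 + p *\<^sub>C Q)"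
    by (simp add: algebra_simps scaleC_scaleC scaleC_add_right)
  ultimately show ?thesis
    using norm_power_convex_combination[OF _ p q u] by simp
qed

text \<open>Membership in \<open>B_set\<close> gives a bound at each point separately. A common
  bound comes from the four corners of a square about \<open>z\<close>: convexity carries it to the
  horizontal edges and then along vertical segments.\<close>

lemma interior_B_set_uniform:
  assumes "z \<in> interior (B_set Q)"
  obtains r M where "r > 0" "\<And>w n. cmod (w - z) \<le> r \<Longrightarrow> norm ((1 + w *\<^sub>C Q) ^ n) \<le> M"
proof -
  obtain e where e: "e > 0" "ball z e \<subseteq> B_set Q"
    using assms mem_interior by blast
  \<comment> \<open>The corners have distance at most \<open>2 * r\<close> from \<open>z\<close>,
    hence lie in the ball.\<close>
  define r where "r = e / 3"
  have r: "r > 0" using e by (simp add: r_def)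
  have corner: "\<exists>M. \<forall>n. norm ((1 + (z + Complex a b) *\<^sub>C Q) ^ n) \<le> M"
    if "\<bar>a\<bar> = r" "\<bar>b\<bar> = r" for a b
  proof -
    have "cmod (Complex a b) \<le> \<bar>a\<bar> + \<bar>b\<bar>"
      using cmod_le[of "Complex a b"] by simp
    then have "z + Complex a b \<in> ball z e"
      using that e by (simp add: dist_norm r_def)
    then show ?thesis using e B_set_iff by blast
  qed
  obtain M1 where M1: "\<And>n. norm ((1 + (z + Complex r r) *\<^sub>C Q) ^ n) \<le> M1"
    using corner[of r r] r by auto
  obtain M2 where M2: "\<And>n. norm ((1 + (z + Complex (-r) r) *\<^sub>C Q) ^ n) \<le> M2"
    using corner[of "-r" r] r by auto
  obtain M3 where M3: "\<And>n. norm ((1 + (z + Complex r (-r)) *\<^sub>C Q) ^ n) \<le> M3"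
    using corner[of r "-r"] r by auto
  obtain M4 where M4: "\<And>n. norm ((1 + (z + Complex (-r) (-r)) *\<^sub>C Q) ^ n) \<le> M4"
    using corner[of "-r" "-r"] r by auto
  have "norm ((1 + w *\<^sub>C Q) ^ n) \<le> (M1 * M2) * (M3 * M4)" if "cmod (w - z) \<le> r" for w n
  proof -
    define a b where "a = Re (w - z)" and "b = Im (w - z)"
    have ab: "\<bar>a\<bar> \<le> r" "\<bar>b\<bar> \<le> r"
      using that abs_Re_le_cmod[of "w - z"] abs_Im_le_cmod[of "w - z"] by (auto simp: a_def b_def)
    \<comment> \<open>Barycentric coordinates of \<open>a\<close> and \<open>b\<close> in the
      interval from \<open>- r\<close> to \<open>r\<close>.\<close>
    define u v where "u = (1 + a / r) / 2" and "v = (1 + b / r) / 2"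
    have u: "0 \<le> u" "u \<le> 1" and v: "0 \<le> v" "v \<le> 1"
      using ab r by (auto simp: u_def v_def field_simps)
    have top: "norm ((1 + (z + Complex a r) *\<^sub>C Q) ^ n) \<le> M1 * M2" for n
      by (rule power_bounded_segment[OF M1 M2 u])
        (use r in \<open>auto simp: complex_eq_iff u_def field_simps\<close>)
    have bottom: "norm ((1 + (z + Complex a (-r)) *\<^sub>C Q) ^ n) \<le> M3 * M4" for n
      by (rule power_bounded_segment[OF M3 M4 u])
        (use r in \<open>auto simp: complex_eq_iff u_def field_simps\<close>)
    have "w = of_real v * (z + Complex a r) + of_real (1 - v) * (z + Complex a (-r))"
      using r by (auto simp: complex_eq_iff v_def a_def b_def field_simps)
    from power_bounded_segment[OF top bottom v this] show ?thesis .
  qed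
  with r show ?thesis by (rule that)
qed

text \<open>The derivative of \<open>(1 + w *\<^sub>C Q) ^ (j + 1)\<close> at \<open>z\<close> is
  \<open>j + 1\<close> times \<open>Q * S ^ j\<close>. Its Cauchy estimate on the circle of radius
  \<open>r\<close> gains the factor \<open>1 / (j + 1)\<close>; averaging over roots of unity
  extracts the coefficient exactly, since the function is a polynomial.\<close>

lemma interior_B_set_subset_T_set: "interior (B_set Q) \<subseteq> T_set 1 Q"
proof
  fix z assume "z \<in> interior (B_set Q)"
  then obtain r M where r: "r > 0"
    and M: "\<And>w n. cmod (w - z) \<le> r \<Longrightarrow> norm ((1 + w *\<^sub>C Q) ^ n) \<le> M"
    by (rule interior_B_set_uniform) blast
  define S where "S = 1 + z *\<^sub>C Q"
  have "norm (z *\<^sub>C Q * S ^ j) \<le> (cmod z * M / r) / real (j + 1) powr 1" for j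
  proof -
    \<comment> \<open>On roots of unity of order \<open>N\<close> the exponent \<open>N - 1\<close>
      acts as \<open>- 1\<close>. For \<open>k\<close> from 0 to \<open>j + 1\<close> only
      \<open>k = 1\<close> makes \<open>N - 1 + k\<close> a multiple of \<open>N\<close>, also when
      \<open>j = 0\<close>.\<close>
    define N where "N = j + 2"
    let ?U = "{\<omega>::complex. \<omega> ^ N = 1}"
    have "(\<Sum>\<omega>\<in>?U. \<omega> ^ (N - 1) *\<^sub>C (1 + (z + of_real r * \<omega>) *\<^sub>C Q) ^ (j + 1))
        = (\<Sum>\<omega>\<in>?U. \<Sum>k\<le>j+1. (of_nat (j + 1 choose k) * of_real r ^ k * \<omega> ^ (N - 1 + k)) *\<^sub>C (Q ^ k * S ^ (j + 1 - k)))"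
    proof (rule sum.cong[OF refl])
      fix \<omega>
      have "1 + (z + of_real r * \<omega>) *\<^sub>C Q = S + (of_real r * \<omega>) *\<^sub>C Q"
        by (simp add: S_def scaleC_add_left)
      moreover have "Q * S = S * Q" by (simp add: S_def algebra_simps)
      ultimately have "(1 + (z + of_real r * \<omega>) *\<^sub>C Q) ^ (j + 1)
        = (\<Sum>k\<le>j+1. (of_nat (j + 1 choose k) * (of_real r * \<omega>) ^ k) *\<^sub>C (Q ^ k * S ^ (j + 1 - k)))"
        by (simp only: binomial_commuting_scaleC)
      then show "\<omega> ^ (N - 1) *\<^sub>C (1 + (z + of_real r * \<omega>) *\<^sub>C Q) ^ (j + 1)
        = (\<Sum>k\<le>j+1. (of_nat (j + 1 choose k) * of_real r ^ k * \<omega> ^ (N - 1 + k)) *\<^sub>C (Q ^ k * S ^ (j + 1 - k)))"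
        by (simp only: scaleC_sum_right scaleC_scaleC power_add power_mult_distrib mult_ac)
    qed
    also have "\<dots> = (\<Sum>k\<le>j+1. (of_nat (j + 1 choose k) * of_real r ^ k * (\<Sum>\<omega>\<in>?U. \<omega> ^ (N - 1 + k))) *\<^sub>C (Q ^ k * S ^ (j + 1 - k)))"
      by (subst sum.swap) (simp only: sum_distrib_left scaleC_sum_left)
    also have "\<dots> = (\<Sum>k\<le>j+1. if k = 1 then (of_nat (j + 1) * of_real r * of_nat N) *\<^sub>C (Q * S ^ j) else 0)"
    proof (rule sum.cong[OF refl])
      fix k assume k: "k \<in> {..j+1}"
      have "N dvd N - 1 + k \<longleftrightarrow> k = 1"
      proof
        assume "N dvd N - 1 + k"
        then obtain m where m: "N - 1 + k = N * m" by (auto elim: dvdE)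
        show "k = 1"
        proof (cases "m \<le> 1")
          case True
          moreover have "m \<noteq> 0" using m by (cases m) (auto simp: N_def)
          ultimately have "m = 1" by simp
          then show ?thesis using m by (simp add: N_def)
        next
          case False
          then have "N * 2 \<le> N * m" by (intro mult_le_mono) auto
          then show ?thesis using m k by (simp add: N_def)
        qed
      qed (simp add: N_def)
      then show "(of_nat (j + 1 choose k) * of_real r ^ k * (\<Sum>\<omega>\<in>?U. \<omega> ^ (N - 1 + k))) *\<^sub>C (Q ^ k * S ^ (j + 1 - k))
          = (if k = 1 then (of_nat (j + 1) * of_real r * of_nat N) *\<^sub>C (Q * S ^ j) else 0)"
        by (subst sum_powers_roots_unity) (simp_all add: N_def)
    qed
    also have "\<dots> = (of_nat (j + 1) * of_real r * of_nat N) *\<^sub>C (Q * S ^ j)"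
      by simp
    finally have eq: "(of_nat (j + 1) * of_real r * of_nat N) *\<^sub>C (Q * S ^ j)
        = (\<Sum>\<omega>\<in>?U. \<omega> ^ (N - 1) *\<^sub>C (1 + (z + of_real r * \<omega>) *\<^sub>C Q) ^ (j + 1))" ..
    have unit: "cmod \<omega> = 1" if "\<omega> \<in> ?U" for \<omega>
    proof -
      have "cmod \<omega> ^ N = 1 ^ N" using that by (simp flip: norm_power)
      then show ?thesis by (rule power_eq_imp_eq_base) (simp_all add: N_def)
    qed
    have "norm (\<Sum>\<omega>\<in>?U. \<omega> ^ (N - 1) *\<^sub>C (1 + (z + of_real r * \<omega>) *\<^sub>C Q) ^ (j + 1)) \<le> (\<Sum>\<omega>\<in>?U. M)"
    proof (rule sum_norm_le)
      fix \<omega> assume "\<omega> \<in> ?U"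
      then have "cmod \<omega> = 1" by (rule unit)
      then have "norm ((1 + (z + of_real r * \<omega>) *\<^sub>C Q) ^ (j + 1)) \<le> M" and "cmod (\<omega> ^ (N - 1)) = 1"
        using r by (simp_all only: M norm_power norm_mult norm_of_real power_one) (intro M, simp add: norm_mult)
      then show "norm (\<omega> ^ (N - 1) *\<^sub>C (1 + (z + of_real r * \<omega>) *\<^sub>C Q) ^ (j + 1)) \<le> M"
        by (simp only: norm_scaleC mult_1)
    qed
    also have "\<dots> = real N * M"
      using card_roots_unity_eq[of N] by (simp add: N_def del: power_Suc)
    also have "(\<Sum>\<omega>\<in>?U. \<omega> ^ (N - 1) *\<^sub>C (1 + (z + of_real r * \<omega>) *\<^sub>C Q) ^ (j + 1))
        = (of_nat (j + 1) * of_real r * of_nat N) *\<^sub>C (Q * S ^ j)"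
      by (rule eq[symmetric])
    also have "norm \<dots> = real N * (real (j + 1) * r * norm (Q * S ^ j))"
      using r by (simp only: norm_scaleC norm_mult norm_of_nat norm_of_real) simp
    finally have "real N * (real (j + 1) * r * norm (Q * S ^ j)) \<le> real N * M" .
    moreover have "0 < real N" by (simp add: N_def)
    ultimately have "real (j + 1) * r * norm (Q * S ^ j) \<le> M"
      by (simp only: mult_le_cancel_left_pos)
    then have "cmod z * (real (j + 1) * r * norm (Q * S ^ j)) \<le> cmod z * M"
      by (rule mult_left_mono) simp
    then have "norm (z *\<^sub>C Q * S ^ j) * (r * real (j + 1)) \<le> cmod z * M"
      by (simp only: scaleC_mult_left norm_scaleC mult_ac)
    moreover have "0 < r * real (j + 1)" using r by simp
    ultimately have "norm (z *\<^sub>C Q * S ^ j) \<le> cmod z * M / (r * real (j + 1))"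
      by (simp only: pos_le_divide_eq)
    then show ?thesis by (simp only: powr_one divide_divide_eq_left of_nat_0_le_iff)
  qed
  then show "z \<in> T_set 1 Q" unfolding T_set_iff S_def by blast
qed

section \<open>From Ritt estimates to power boundedness\<close>

lemma scaleR_scaleC: "r *\<^sub>R c *\<^sub>C x = (of_real r * c) *\<^sub>C (x :: 'a::complex_normed_vector)"
  by (simp only: scaleC_of_real flip: scaleC_scaleC)

text \<open>The left side is one term of the exponential series.\<close>

lemma power_self_div_fact_le_exp: "real k ^ k / fact k \<le> exp (real k)"
proof -
  have "(\<Sum>n\<in>{k}. inverse (fact n) * real k ^ n) \<le> (\<Sum>n. inverse (fact n) * real k ^ n)"
    by (rule sum_le_suminf) (auto intro: summable_exp)
  then show ?thesis by (simp add: exp_def divide_inverse mult.commute)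
qed

text \<open>With \<open>q = n div k\<close>, the product splits into \<open>k\<close> blocks
  \<open>X * S ^ (q - 1)\<close> and a remainder \<open>S ^ r\<close>. Each block is at most
  \<open>C / q\<close>, and \<open>n \<le> 2 * q * k\<close>.\<close>

lemma norm_power_mult_power_le:
  fixes S X :: "'a::real_normed_algebra_1"
  assumes comm: "X * S = S * X"
    and C: "\<And>j. norm (X * S ^ j) \<le> C / real (j + 1)" and M: "\<And>j. norm (S ^ j) \<le> M"
    and k: "1 \<le> k" "k \<le> n"
  shows "norm (X ^ k * S ^ (n - k)) \<le> (2 * C * real k / real n) ^ k * M"
proof -
  have C0: "0 \<le> C" using order_trans[OF norm_ge_zero C[of 0]] by simp
  define q r where "q = n div k" and "r = n mod k"
  have n: "n = q * k + r" by (simp add: q_def r_def)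
  have q: "q \<ge> 1" using k by (simp add: q_def div_greater_zero_iff Suc_le_eq)
  have "r < k" using k by (simp add: r_def)
  then have "n < q * k + k" unfolding n by simp
  also have "\<dots> \<le> 2 * q * k" using q by (cases q) auto
  finally have "real n \<le> real (2 * q * k)" by (simp only: of_nat_le_iff less_imp_le)
  then have nq: "real n \<le> real q * (2 * real k)" by simp
  have "(q - 1) * k + r = n - k" unfolding n using q by (cases q) auto
  then have "S ^ (n - k) = (S ^ (q - 1)) ^ k * S ^ r"
    by (metis power_add power_mult)
  moreover have "X * S ^ (q - 1) = S ^ (q - 1) * X"
    by (rule power_commuting_commutes[OF comm[symmetric], symmetric])
  then have "(X * S ^ (q - 1)) ^ k = X ^ k * (S ^ (q - 1)) ^ k"
    by (rule power_mult_commuting)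
  ultimately have "X ^ k * S ^ (n - k) = (X * S ^ (q - 1)) ^ k * S ^ r"
    by (simp only: mult.assoc)
  then have "norm (X ^ k * S ^ (n - k)) \<le> norm ((X * S ^ (q - 1)) ^ k) * norm (S ^ r)"
    by (simp add: norm_mult_ineq)
  also have "\<dots> \<le> norm (X * S ^ (q - 1)) ^ k * M"
    by (intro mult_mono norm_power_ineq M) auto
  also have "\<dots> \<le> (C / real q) ^ k * M"
    using C[of "q - 1"] q order_trans[OF norm_ge_zero M[of 0]]
    by (intro mult_right_mono power_mono) auto
  also have "\<dots> \<le> (2 * C * real k / real n) ^ k * M"
  proof (intro mult_right_mono power_mono)
    have "C * real n \<le> C * (real q * (2 * real k))" using nq C0 by (rule mult_left_mono)
    then show "C / real q \<le> 2 * C * real k / real n"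
      using k q by (simp add: field_simps)
  qed (use C0 order_trans[OF norm_ge_zero M[of 0]] in auto)
  finally show ?thesis .
qed

text \<open>In the binomial expansion of \<open>(S + \<eta> *\<^sub>C X) ^ n\<close> the bounds
  \<open>n ^ k / fact k\<close> for the binomial coefficient and
  \<open>k ^ k / fact k \<le> exp k\<close> cancel all powers of \<open>n\<close>. What remains is a
  geometric series with a ratio independent of \<open>n\<close>.\<close>

lemma T_set_B_set_imp_interior:
  fixes Q :: "'a::{complex_banach, perfect_space} cop"
  assumes T: "z \<in> T_set 1 Q" and B: "z \<in> B_set Q" and z: "z \<noteq> 0"
  shows "z \<in> interior (B_set Q)"
proof -
  define X S where "X = z *\<^sub>C Q" and "S = 1 + X"
  obtain C where C: "\<And>j. norm (X * S ^ j) \<le> C / real (j + 1)"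
    using T by (auto simp: T_set_iff X_def S_def simp del: scaleC_mult_left of_nat_add)
  obtain M where M: "\<And>j. norm (S ^ j) \<le> M"
    using B by (auto simp: B_set_iff X_def S_def)
  have C0: "0 \<le> C" using order_trans[OF norm_ge_zero C[of 0]] by simp
  have M0: "0 \<le> M" by (rule order_trans[OF norm_ge_zero M])
  have comm: "X * S = S * X" by (simp add: S_def algebra_simps)
  \<comment> \<open>Chosen so that this ratio, \<open>2 * C * exp 1 * cmod \<eta>\<close>, is at
    most \<open>1 / 2\<close>; \<open>C + 1\<close> keeps the denominator positive when
    \<open>C = 0\<close>.\<close>
  define \<epsilon> where "\<epsilon> = cmod z / (4 * (C + 1) * exp 1)"
  have \<epsilon>: "\<epsilon> > 0" using z C0 by (simp add: \<epsilon>_def add_nonneg_pos)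
  have "w \<in> B_set Q" if w: "w \<in> ball z \<epsilon>" for w
  proof -
    \<comment> \<open>The relative displacement, so that
      \<open>w *\<^sub>C Q = X + \<eta> *\<^sub>C X\<close>.\<close>
    define \<eta> where "\<eta> = (w - z) / z"
    have "4 * C * exp 1 * cmod \<eta> \<le> 4 * (C + 1) * exp 1 * cmod \<eta>"
      by (intro mult_right_mono) auto
    also have "\<dots> \<le> 1"
    proof -
      have "cmod (w - z) < cmod z / (4 * (C + 1) * exp 1)"
        using w by (simp add: \<epsilon>_def dist_norm norm_minus_commute)
      then have "4 * (C + 1) * exp 1 * cmod (w - z) \<le> cmod z"
        using C0 by (subst (asm) pos_less_divide_eq) (auto simp: add_nonneg_pos mult.commute)
      then have "4 * (C + 1) * exp 1 * cmod (w - z) / cmod z \<le> 1"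
        using z by (subst pos_divide_le_eq) auto
      then show ?thesis by (simp only: \<eta>_def norm_divide times_divide_eq_right)
    qed
    finally have \<eta>: "2 * C * exp 1 * cmod \<eta> \<le> 1 / 2" by simp
    have wS: "1 + w *\<^sub>C Q = S + \<eta> *\<^sub>C X"
    proof -
      have "w = z + \<eta> * z" using z by (simp add: \<eta>_def)
      then have "w *\<^sub>C Q = X + \<eta> *\<^sub>C X"
        by (simp only: X_def scaleC_scaleC flip: scaleC_add_left)
      then show ?thesis by (simp only: S_def add.assoc)
    qed
    have "norm ((1 + w *\<^sub>C Q) ^ n) \<le> 2 * M" for n
    proof -
      have term_le: "norm ((of_nat (n choose k) * \<eta> ^ k) *\<^sub>C (X ^ k * S ^ (n - k))) \<le> M * (1 / 2) ^ k"
        if "k \<le> n" for k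
      proof (cases "k = 0")
        case True
        then show ?thesis using M[of n] by simp
      next
        case False
        have "norm ((of_nat (n choose k) * \<eta> ^ k) *\<^sub>C (X ^ k * S ^ (n - k)))
            = real (n choose k) * cmod \<eta> ^ k * norm (X ^ k * S ^ (n - k))"
          by (simp add: norm_scaleC norm_mult norm_power)
        also have "\<dots> \<le> (real n ^ k / fact k) * cmod \<eta> ^ k * ((2 * C * real k / real n) ^ k * M)"
        proof (intro mult_mono mult_right_mono)
          have "real ((n choose k) * fact k) \<le> real (n ^ k)"
            using binomial_fact_pow of_nat_mono by blast
          then show "real (n choose k) \<le> real n ^ k / fact k"
            by (simp add: field_simps)
          show "norm (X ^ k * S ^ (n - k)) \<le> (2 * C * real k / real n) ^ k * M"
            using norm_power_mult_power_le[OF comm C M, of k n] False that by simp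
        qed auto
        also have "\<dots> = M * (2 * C * cmod \<eta>) ^ k * (real k ^ k / fact k)"
          using False that by (simp add: power_mult_distrib power_divide)
        also have "\<dots> \<le> M * (2 * C * cmod \<eta>) ^ k * exp (real k)"
          using C0 M0 by (intro mult_left_mono power_self_div_fact_le_exp) auto
        also have "\<dots> = M * (2 * C * exp 1 * cmod \<eta>) ^ k"
          using exp_of_nat_mult[of k "1::real"] by (simp add: power_mult_distrib)
        also have "\<dots> \<le> M * (1 / 2) ^ k"
          using \<eta> C0 M0 by (intro mult_left_mono power_mono) auto
        finally show ?thesis .
      qed
      have "norm ((1 + w *\<^sub>C Q) ^ n) \<le> (\<Sum>k\<le>n. M * (1 / 2) ^ k)"
        unfolding wS binomial_commuting_scaleC[OF comm] by (rule sum_norm_le) (simp add: term_le)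
      also have "\<dots> = M * (\<Sum>k<Suc n. (1 / 2) ^ k)"
        by (simp only: sum_distrib_left lessThan_Suc_atMost)
      also have "\<dots> \<le> M * 2"
        using M0 by (intro mult_left_mono, subst geometric_sum) simp_all
      finally show ?thesis by (simp only: mult.commute)
    qed
    then show ?thesis unfolding B_set_iff by blast
  qed
  then show ?thesis using \<epsilon> by (auto simp: mem_interior)
qed

lemma one_plus_power_eq_sum:
  fixes X :: "'a::ring_1"
  shows "(1 + X) ^ n = 1 + (\<Sum>i<n. (1 + X) ^ i * X)"
  by (induction n) (simp_all add: power_Suc2 distrib_left del: power_Suc)

text \<open>
  With \<open>R = (1 - s X)\<^sup>-\<^sup>1\<close> and \<open>S = 1 + X\<close> one has \<open>S\<^sup>j = S\<^sup>j R - s X S\<^sup>j R\<close>. The choice of \<open>s\<close>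
  proportional to \<open>j + 1\<close> bounds the last term, while \<open>S\<^sup>j R = R + (\<Sum>i<j. S\<^sup>i X R)\<close> with
  \<open>X R = (R - 1) / s\<close> is small enough to be absorbed in a strong induction on \<open>j\<close>.
\<close>

lemma T_set_A_set_imp_B_set:
  assumes inv: "\<And>w. cop_invertible (1 - w *\<^sub>C Q)"
    and T: "z \<in> T_set 1 Q" and A: "z \<in> A_set Q"
  shows "z \<in> B_set Q"
proof -
  define X S where "X = z *\<^sub>C Q" and "S = 1 + X"
  obtain C where C: "\<And>j. norm (X * S ^ j) \<le> C / real (j + 1)"
    using T by (auto simp: T_set_iff X_def S_def simp del: scaleC_mult_left of_nat_add)
  have C0: "0 \<le> C" using order_trans[OF norm_ge_zero C[of 0]] by simp
  define R where "R s = cop_inverse (1 - s *\<^sub>R X)" for s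
  obtain K s0 where K: "\<And>s. s \<ge> s0 \<Longrightarrow> norm (R s) \<le> K"
    using A by (auto simp: A_set_iff R_def X_def)
  have K0: "0 \<le> K" by (rule order_trans[OF norm_ge_zero K[OF order_refl]])
  have R: "(1 - s *\<^sub>R X) * R s = 1" for s
    using cop_inverse(2)[OF inv[of "of_real s * z"]]
    by (simp only: R_def X_def scaleR_scaleC)
  \<comment> \<open>The first entry makes the \<open>j\<close> terms from the induction hypothesis
    add up to at most \<open>L / 2\<close>; the second keeps \<open>s\<close> in the range where
    \<open>K\<close> is a bound.\<close>
  define a where "a = max (2 * (K + 1)) s0"
  have a: "a \<ge> 2 * (K + 1)" "a \<ge> s0" "a > 0" using K0 by (auto simp: a_def)
  \<comment> \<open>The solution of \<open>L = K + L / 2 + a * C * K\<close>, which closes the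
    induction.\<close>
  define L where "L = 2 * (K + a * C * K)"
  have L0: "0 \<le> L" using K0 C0 a by (simp add: L_def)
  have "norm (S ^ j) \<le> L" for j
  proof (induction j rule: less_induct)
    case (less j)
    define s where "s = a * real (j + 1)"
    have s: "s > 0" "s \<ge> s0"
    proof -
      show "s > 0" using a by (simp add: s_def)
      have "a * 1 \<le> s" unfolding s_def using a by (intro mult_left_mono) auto
      with a(2) show "s \<ge> s0" by linarith
    qed
    note Ks = K[OF s(2)]
    have XR: "s *\<^sub>R (X * R s) = R s - 1"
      using R[of s] by (simp add: left_diff_distrib algebra_simps)
    have "s * norm (X * R s) = norm (s *\<^sub>R (X * R s))" using s by simp
    also have "\<dots> \<le> K + 1"
      unfolding XR using norm_triangle_ineq4[of "R s" 1] Ks by simp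
    finally have XR_le: "norm (X * R s) \<le> (K + 1) / s" using s by (simp add: field_simps)
    have "S ^ j * R s = R s + (\<Sum>i<j. S ^ i * (X * R s))"
      unfolding S_def by (subst one_plus_power_eq_sum) (simp add: distrib_right sum_distrib_right mult.assoc)
    then have "norm (S ^ j * R s) \<le> norm (R s) + norm (\<Sum>i<j. S ^ i * (X * R s))"
      by (simp add: norm_triangle_ineq)
    also have "\<dots> \<le> K + (\<Sum>i<j. L * ((K + 1) / s))"
    proof (intro add_mono Ks sum_norm_le)
      fix i assume "i \<in> {..<j}"
      then have "norm (S ^ i) \<le> L" by (simp add: less)
      have "norm (S ^ i * (X * R s)) \<le> norm (S ^ i) * norm (X * R s)" by (rule norm_mult_ineq)
      also have "\<dots> \<le> L * ((K + 1) / s)"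
        by (rule mult_mono[OF \<open>norm (S ^ i) \<le> L\<close> XR_le L0]) simp
      finally show "norm (S ^ i * (X * R s)) \<le> L * ((K + 1) / s)" .
    qed
    also have "(\<Sum>i<j. L * ((K + 1) / s)) \<le> L / 2"
    proof -
      have "2 * (K + 1) * real j \<le> a * real (j + 1)"
        using a K0 by (intro mult_mono) auto
      then have "real j * ((K + 1) / s) \<le> 1 / 2"
        using s by (simp add: s_def field_simps)
      then have "L * (real j * ((K + 1) / s)) \<le> L * (1 / 2)"
        using L0 by (rule mult_left_mono)
      then show ?thesis by (simp add: mult.left_commute)
    qed
    finally have 1: "norm (S ^ j * R s) \<le> K + L / 2" by simp
    have "norm (s *\<^sub>R (X * S ^ j * R s)) \<le> s * (C / real (j + 1) * K)"
    proof -
      have "norm (X * S ^ j * R s) \<le> norm (X * S ^ j) * norm (R s)" by (rule norm_mult_ineq)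
      also have "\<dots> \<le> C / real (j + 1) * K"
        by (rule mult_mono[OF C Ks]) (use C0 in auto)
      finally have "s * norm (X * S ^ j * R s) \<le> s * (C / real (j + 1) * K)"
        using s by (intro mult_left_mono) auto
      then show ?thesis using s by simp
    qed
    also have "\<dots> = a * C * K" by (simp add: s_def field_simps)
    finally have 2: "norm (s *\<^sub>R (X * S ^ j * R s)) \<le> a * C * K" .
    have "S ^ j * X = X * S ^ j"
      by (rule power_commuting_commutes) (simp add: S_def algebra_simps)
    moreover have "S ^ j = S ^ j * ((1 - s *\<^sub>R X) * R s)" by (simp add: R)
    ultimately have "S ^ j = S ^ j * R s - s *\<^sub>R (X * S ^ j * R s)"
      by (simp add: left_diff_distrib right_diff_distrib flip: mult.assoc)
    then have "norm (S ^ j) = norm (S ^ j * R s - s *\<^sub>R (X * S ^ j * R s))" by (rule arg_cong)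
    also have "\<dots> \<le> norm (S ^ j * R s) + norm (s *\<^sub>R (X * S ^ j * R s))"
      by (rule norm_triangle_ineq4)
    also have "\<dots> \<le> K + L / 2 + a * C * K" using 1 2 by (rule add_mono)
    also have "\<dots> = L" by (simp add: L_def field_simps)
    finally show ?case .
  qed
  then show ?thesis unfolding B_set_iff X_def S_def by blast
qed

section \<open>Resolvents\<close>

text \<open>
  Differentiating \<open>exp (- \<nu> t) exp (t B) (\<nu> - B)\<^sup>-\<^sup>1\<close> and using the mean value inequality replaces
  the Laplace transform.
\<close>

lemma resolvent_bound_bounded_semigroup:
  fixes B R :: "'a::{complex_banach, perfect_space} cop"
  assumes M: "\<And>t. 0 \<le> t \<Longrightarrow> norm (exp (t *\<^sub>R B)) \<le> M"
    and \<nu>: "Re \<nu> > 0" and R: "(\<nu> *\<^sub>C 1 - B) * R = 1"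
  shows "norm R \<le> M / Re \<nu>"
proof -
  have M0: "0 \<le> M" by (rule order_trans[OF norm_ge_zero M[OF order_refl]])
  define F where "F t = exp (- \<nu> * of_real t) *\<^sub>C (exp (t *\<^sub>R B) * R)" for t
  define F' where "F' t = - (exp (- \<nu> * of_real t) *\<^sub>C exp (t *\<^sub>R B))" for t
  \<comment> \<open>An antiderivative of the bound \<open>M * exp (- Re \<nu> * t)\<close> for
    \<open>norm (F' t)\<close>; its increments from 0 never exceed \<open>M / Re \<nu>\<close>.
    Since \<open>F 0 = R\<close> and \<open>F t\<close> tends to 0, this bounds
    \<open>R\<close>.\<close>
  define \<phi> where "\<phi> t = - (M / Re \<nu>) * exp (- Re \<nu> * t)" for t
  have dF: "(F has_vector_derivative F' t) (at t)" for t
  proof -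
    have "((\<lambda>t. exp (- \<nu> * of_real t)) has_vector_derivative (exp (- \<nu> * of_real t) * (- \<nu>))) (at t)"
      by (auto intro!: derivative_eq_intros has_vector_derivative_real_field)
    moreover have "((\<lambda>t. exp (t *\<^sub>R B) * R) has_vector_derivative (exp (t *\<^sub>R B) * B) * R) (at t)"
      by (rule bounded_linear.has_vector_derivative[OF bounded_linear_mult_left
            exp_scaleR_has_vector_derivative_right])
    ultimately have "(F has_vector_derivative
        exp (- \<nu> * of_real t) *\<^sub>C ((exp (t *\<^sub>R B) * B) * R)
          + (exp (- \<nu> * of_real t) * (- \<nu>)) *\<^sub>C (exp (t *\<^sub>R B) * R)) (at t)"
      unfolding F_def by (rule bounded_bilinear.has_vector_derivative[OF bounded_bilinear_scaleC])
    also have "exp (- \<nu> * of_real t) *\<^sub>C ((exp (t *\<^sub>R B) * B) * R)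
          + (exp (- \<nu> * of_real t) * (- \<nu>)) *\<^sub>C (exp (t *\<^sub>R B) * R)
        = - (exp (- \<nu> * of_real t) *\<^sub>C (exp (t *\<^sub>R B) * ((\<nu> *\<^sub>C 1 - B) * R)))"
      by (simp add: left_diff_distrib right_diff_distrib scaleC_diff_right scaleC_scaleC
          scaleC_minus_left mult.assoc)
    finally show ?thesis by (simp add: F'_def R)
  qed
  have d\<phi>: "(\<phi> has_vector_derivative M * exp (- Re \<nu> * t)) (at t)" for t
  proof -
    have "(\<phi> has_real_derivative - (M / Re \<nu>) * (exp (- Re \<nu> * t) * (- Re \<nu>))) (at t)"
      unfolding \<phi>_def by (auto intro!: derivative_eq_intros)
    then show ?thesis
      using \<nu> by (simp add: has_real_derivative_iff_has_vector_derivative)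
  qed
  have le: "norm R \<le> M / Re \<nu> + (M * norm R) * exp (- (Re \<nu> * t))" if "0 < t" for t
  proof -
    have "norm (F t - F 0) \<le> \<phi> t - \<phi> 0"
    proof (rule differentiable_bound_general[OF that _ _ dF d\<phi>])
      show "continuous_on {0..t} F"
        using dF by (auto intro!: continuous_at_imp_continuous_on has_vector_derivative_continuous)
      show "continuous_on {0..t} \<phi>"
        unfolding \<phi>_def by (intro continuous_intros)
      fix x assume "0 < x" "x < t"
      then have "exp (- (Re \<nu> * x)) * norm (exp (x *\<^sub>R B)) \<le> exp (- (Re \<nu> * x)) * M"
        by (intro mult_left_mono M) auto
      then show "norm (F' x) \<le> M * exp (- Re \<nu> * x)"
        by (simp add: F'_def norm_scaleC mult.commute)
    qed
    also have "\<dots> \<le> M / Re \<nu>"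
      using \<nu> M0 by (simp add: \<phi>_def)
    finally have 1: "norm (F t - F 0) \<le> M / Re \<nu>" .
    have "norm (F t) \<le> exp (- (Re \<nu> * t)) * (M * norm R)"
    proof -
      have "norm (exp (t *\<^sub>R B) * R) \<le> norm (exp (t *\<^sub>R B)) * norm R" by (rule norm_mult_ineq)
      also have "\<dots> \<le> M * norm R" using that by (intro mult_right_mono M) auto
      finally show ?thesis by (simp add: F_def norm_scaleC)
    qed
    moreover have "R = F t - (F t - F 0)" by (simp add: F_def)
    then have "norm R \<le> norm (F t) + norm (F t - F 0)"
      using norm_triangle_ineq4[of "F t" "F t - F 0"] by simp
    ultimately show ?thesis using 1 by (simp add: mult.commute)
  qed
  have "((\<lambda>t. exp (- (Re \<nu> * t))) \<longlongrightarrow> 0) at_top"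
    using \<nu> by (auto intro!: filterlim_compose[OF exp_at_bot] filterlim_tendsto_pos_mult_at_top
        filterlim_ident simp: filterlim_uminus_at_bot)
  then have "((\<lambda>t. M / Re \<nu> + (M * norm R) * exp (- (Re \<nu> * t))) \<longlongrightarrow> M / Re \<nu> + (M * norm R) * 0) at_top"
    by (intro tendsto_intros)
  moreover have "\<forall>\<^sub>F t in at_top. norm R \<le> M / Re \<nu> + (M * norm R) * exp (- (Re \<nu> * t))"
    using eventually_gt_at_top[of 0] by eventually_elim (rule le)
  ultimately have "norm R \<le> M / Re \<nu> + (M * norm R) * 0"
    by (rule tendsto_lowerbound) simp
  then show ?thesis by simp
qed

text \<open>With \<open>\<nu> = \<zeta> / w\<close> the operator \<open>1 - w *\<^sub>C P\<close> is
  \<open>inverse \<nu>\<close> times \<open>\<nu> *\<^sub>C 1 - \<zeta> *\<^sub>C P\<close>, to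
  which the half-plane estimate applies.\<close>

lemma resolvent_bound_direction:
  fixes P :: "'a::{complex_banach, perfect_space} cop"
  assumes M: "\<And>t. 0 \<le> t \<Longrightarrow> norm (exp (t *\<^sub>R (\<zeta> *\<^sub>C P))) \<le> M"
    and w: "w \<noteq> 0" "Re (\<zeta> / w) > 0" and inv: "cop_invertible (1 - w *\<^sub>C P)"
  shows "norm (cop_inverse (1 - w *\<^sub>C P)) \<le> cmod (\<zeta> / w) * (M / Re (\<zeta> / w))"
proof -
  define \<nu> where "\<nu> = \<zeta> / w"
  have \<nu>: "\<nu> \<noteq> 0" "Re \<nu> > 0" using w by (auto simp: \<nu>_def)
  let ?I = "cop_inverse (1 - w *\<^sub>C P)"
  have "\<nu> *\<^sub>C 1 - \<zeta> *\<^sub>C P = \<nu> *\<^sub>C (1 - w *\<^sub>C P)"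
    using w by (simp add: scaleC_diff_right scaleC_scaleC \<nu>_def)
  then have "(\<nu> *\<^sub>C 1 - \<zeta> *\<^sub>C P) * (inverse \<nu> *\<^sub>C ?I) = 1"
    using \<nu> cop_inverse(2)[OF inv] by (simp add: scaleC_scaleC)
  from resolvent_bound_bounded_semigroup[OF M \<nu>(2) this]
  have "norm ?I / cmod \<nu> \<le> M / Re \<nu>"
    by (simp add: norm_scaleC norm_inverse divide_inverse mult.commute)
  then show ?thesis
    using \<nu> unfolding \<nu>_def[symmetric] by (subst (asm) pos_divide_le_eq) (auto simp: mult.commute)
qed

lemma resolvent_identity:
  fixes P :: "'a::{complex_banach, perfect_space} cop"
  assumes inv: "\<And>w. cop_invertible (1 - w *\<^sub>C P)"
  shows "cop_inverse (1 - w *\<^sub>C P) - cop_inverse (1 - v *\<^sub>C P)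
    = (w - v) *\<^sub>C (cop_inverse (1 - w *\<^sub>C P) * P * cop_inverse (1 - v *\<^sub>C P))"
proof -
  let ?W = "cop_inverse (1 - w *\<^sub>C P)" and ?V = "cop_inverse (1 - v *\<^sub>C P)"
  have "?W - ?V = ?W * ((1 - v *\<^sub>C P) * ?V) - (?W * (1 - w *\<^sub>C P)) * ?V"
    by (simp only: cop_inverse[OF inv] mult_1 mult_1_right)
  also have "\<dots> = (w - v) *\<^sub>C (?W * P * ?V)"
    by (simp add: left_diff_distrib right_diff_distrib scaleC_diff_left mult.assoc)
  finally show ?thesis .
qed

text \<open>The resolvent identity bounds the difference by a multiple of the unknown
  \<open>norm (?R w)\<close>. For \<open>w\<close> close to \<open>v\<close> this multiple is at
  most one half and is absorbed, which leaves a Lipschitz estimate at \<open>v\<close>.\<close>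

lemma continuous_resolvent:
  fixes P :: "'a::{complex_banach, perfect_space} cop"
  assumes inv: "\<And>w. cop_invertible (1 - w *\<^sub>C P)"
  shows "continuous_on A (\<lambda>w. cop_inverse (1 - w *\<^sub>C P))"
proof (rule continuous_at_imp_continuous_on, rule ballI)
  fix v
  let ?R = "\<lambda>w. cop_inverse (1 - w *\<^sub>C P)"
  define a where "a = norm P * norm (?R v)"
  have a0: "0 \<le> a" by (simp add: a_def)
  have diff_le: "norm (?R w - ?R v) \<le> cmod (w - v) * (norm (?R w) * a)" for w
  proof -
    have "norm (?R w * P * ?R v) \<le> norm (?R w) * (norm P * norm (?R v))"
      unfolding mult.assoc
      by (rule order_trans[OF norm_mult_ineq], rule mult_left_mono[OF norm_mult_ineq]) simp
    then show ?thesis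
      unfolding resolvent_identity[OF inv, of w v] norm_scaleC a_def
      by (rule mult_left_mono) simp
  qed
  have "norm (?R w - ?R v) \<le> cmod (w - v) * (2 * norm (?R v) * a)"
    if "cmod (w - v) < 1 / (2 * (a + 1))" for w
  proof -
    have "cmod (w - v) * (2 * (a + 1)) \<le> 1"
      using that a0 by (subst (asm) pos_less_divide_eq) auto
    then have "cmod (w - v) * a \<le> 1 / 2"
      using norm_ge_zero[of "w - v"] unfolding distrib_left mult.left_commute[of _ 2] by linarith
    then have "norm (?R w) * (cmod (w - v) * a) \<le> norm (?R w) * (1 / 2)"
      by (rule mult_left_mono) simp
    then have "norm (?R w - ?R v) \<le> norm (?R w) / 2"
      using diff_le[of w] by (simp only: mult_ac)
    moreover have "norm (?R w) \<le> norm (?R v) + norm (?R w - ?R v)"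
      by (rule norm_triangle_sub)
    ultimately have "norm (?R w) \<le> 2 * norm (?R v)" by linarith
    then have "cmod (w - v) * (norm (?R w) * a) \<le> cmod (w - v) * (2 * norm (?R v) * a)"
      using a0 by (intro mult_left_mono mult_right_mono) auto
    with diff_le show ?thesis by (rule order_trans)
  qed
  then have "\<forall>\<^sub>F w in at v. norm (?R w - ?R v) \<le> cmod (w - v) * (2 * norm (?R v) * a)"
    unfolding eventually_at dist_norm
    using a0 by (intro exI[of _ "1 / (2 * (a + 1))"]) auto
  moreover have "((\<lambda>w. cmod (w - v) * (2 * norm (?R v) * a)) \<longlongrightarrow> 0) (at v)"
    by (rule tendsto_eq_intros tendsto_ident_at refl | simp)+
  ultimately have "((\<lambda>w. ?R w - ?R v) \<longlongrightarrow> 0) (at v)"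
    by (rule Lim_null_comparison)
  then show "isCont ?R v"
    unfolding isCont_def by (rule LIM_zero_cancel)
qed

lemma sum_powers_mult_one_minus:
  fixes x :: "'a::ring_1"
  shows "(1 - x) * (\<Sum>j<n. x ^ j) = 1 - x ^ n"
  by (induction n) (simp_all add: distrib_left left_diff_distrib)

text \<open>The partial fraction decomposition of \<open>(w P)\<^sup>k (1 - (w P)\<^sup>N)\<^sup>-\<^sup>1\<close>.\<close>

lemma sum_roots_unity_resolvent:
  fixes P :: "'a::{complex_banach, perfect_space} cop"
  assumes inv: "\<And>w. cop_invertible (1 - w *\<^sub>C P)" and k: "k < N"
  shows "(\<Sum>\<omega> | \<omega> ^ N = 1. \<omega> ^ (N - k) *\<^sub>C cop_inverse (1 - (\<omega> * w) *\<^sub>C P)) * (1 - w ^ N *\<^sub>C P ^ N)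
    = (of_nat N * w ^ k) *\<^sub>C P ^ k"
proof -
  let ?U = "{\<omega>::complex. \<omega> ^ N = 1}"
  have "(\<Sum>\<omega>\<in>?U. \<omega> ^ (N - k) *\<^sub>C cop_inverse (1 - (\<omega> * w) *\<^sub>C P)) * (1 - w ^ N *\<^sub>C P ^ N)
      = (\<Sum>\<omega>\<in>?U. \<Sum>j<N. (w ^ j * \<omega> ^ (N - k + j)) *\<^sub>C P ^ j)"
    unfolding sum_distrib_right
  proof (rule sum.cong[OF refl])
    fix \<omega> assume "\<omega> \<in> ?U"
    then have "1 - w ^ N *\<^sub>C P ^ N = 1 - ((\<omega> * w) *\<^sub>C P) ^ N"
      by (simp add: power_scaleC power_mult_distrib)
    also have "\<dots> = (1 - (\<omega> * w) *\<^sub>C P) * (\<Sum>j<N. ((\<omega> * w) *\<^sub>C P) ^ j)"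
      by (rule sum_powers_mult_one_minus[symmetric])
    finally have "cop_inverse (1 - (\<omega> * w) *\<^sub>C P) * (1 - w ^ N *\<^sub>C P ^ N)
        = (\<Sum>j<N. ((\<omega> * w) *\<^sub>C P) ^ j)"
      by (simp only: cop_inverse(1)[OF inv] mult_1 flip: mult.assoc)
    then show "\<omega> ^ (N - k) *\<^sub>C cop_inverse (1 - (\<omega> * w) *\<^sub>C P) * (1 - w ^ N *\<^sub>C P ^ N)
        = (\<Sum>j<N. (w ^ j * \<omega> ^ (N - k + j)) *\<^sub>C P ^ j)"
      by (simp only: scaleC_mult_left scaleC_sum_right power_scaleC scaleC_scaleC power_mult_distrib
          power_add mult_ac)
  qed
  also have "\<dots> = (\<Sum>j<N. (w ^ j * (\<Sum>\<omega>\<in>?U. \<omega> ^ (N - k + j))) *\<^sub>C P ^ j)"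
    by (subst sum.swap) (simp only: sum_distrib_left scaleC_sum_left)
  also have "\<dots> = (\<Sum>j<N. if j = k then (w ^ k * of_nat N) *\<^sub>C P ^ k else 0)"
  proof (rule sum.cong[OF refl])
    fix j assume j: "j \<in> {..<N}"
    \<comment> \<open>The exponent lies strictly between \<open>0\<close> and \<open>2 * N\<close>,
      so the only multiple of \<open>N\<close> available is \<open>N\<close> itself.\<close>
    have "N dvd N - k + j \<longleftrightarrow> j = k"
    proof
      assume "N dvd N - k + j"
      then obtain m where m: "N - k + j = N * m" by (auto elim: dvdE)
      show "j = k"
      proof (cases "m \<le> 1")
        case True
        then have "m = 0 \<or> m = 1" by linarith
        then show ?thesis using m k by auto
      next
        case False
        then have "N * 2 \<le> N * m" by (intro mult_le_mono) auto
        moreover have "N - k + j < N * 2" using k j by simp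
          ultimately show ?thesis using m by simp
      qed
    qed (use k in simp)
    then show "(w ^ j * (\<Sum>\<omega>\<in>?U. \<omega> ^ (N - k + j))) *\<^sub>C P ^ j
        = (if j = k then (w ^ k * of_nat N) *\<^sub>C P ^ k else 0)"
      using k by (subst sum_powers_roots_unity) simp_all
  qed
  also have "\<dots> = (of_nat N * w ^ k) *\<^sub>C P ^ k"
    using k by (simp add: mult.commute)
  finally show ?thesis .
qed

section \<open>Quasinilpotent generators of bounded groups\<close>

text \<open>The case \<open>k = 0\<close> of the partial fractions, where every weight is
  \<open>\<omega> ^ N = 1\<close>.\<close>

lemma mean_resolvent_roots_unity:
  fixes P :: "'a::{complex_banach, perfect_space} cop"
  assumes inv: "\<And>w. cop_invertible (1 - w *\<^sub>C P)" and N: "N > 0"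
  shows "((\<Sum>\<omega> | \<omega> ^ N = 1. cop_inverse (1 - (\<omega> * w) *\<^sub>C P)) /\<^sub>R real N) * (1 - w ^ N *\<^sub>C P ^ N) = 1"
proof -
  have "(\<Sum>\<omega> | \<omega> ^ N = 1. cop_inverse (1 - (\<omega> * w) *\<^sub>C P))
      = (\<Sum>\<omega> | \<omega> ^ N = 1. \<omega> ^ (N - 0) *\<^sub>C cop_inverse (1 - (\<omega> * w) *\<^sub>C P))"
    by (rule sum.cong) auto
  then have "(\<Sum>\<omega> | \<omega> ^ N = 1. cop_inverse (1 - (\<omega> * w) *\<^sub>C P)) * (1 - w ^ N *\<^sub>C P ^ N)
      = real N *\<^sub>R 1"
    using sum_roots_unity_resolvent[OF inv, of 0 N w] N by (simp add: scaleC_of_nat)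
  then show ?thesis using N by simp
qed

lemma norm_root_unity:
  fixes \<omega> :: complex
  assumes "\<omega> ^ N = 1" "N > 0"
  shows "cmod \<omega> = 1"
proof -
  have "cmod \<omega> ^ N = 1 ^ N" using assms by (simp flip: norm_power)
  then show ?thesis by (rule power_eq_imp_eq_base) (use assms in auto)
qed

lemma norm_mean_le:
  fixes f :: "complex \<Rightarrow> 'a::real_normed_vector"
  assumes N: "N > 0" and le: "\<And>\<omega>. \<omega> ^ N = 1 \<Longrightarrow> norm (f \<omega>) \<le> e"
  shows "norm ((\<Sum>\<omega> | \<omega> ^ N = 1. f \<omega>) /\<^sub>R real N) \<le> e"
proof -
  have "norm (\<Sum>\<omega> | \<omega> ^ N = 1. f \<omega>) \<le> (\<Sum>\<omega>::complex | \<omega> ^ N = 1. e)"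
    by (rule sum_norm_le) (simp add: le)
  also have "\<dots> = real N * e" using card_roots_unity_eq[OF N] by simp
  finally show ?thesis using N by (simp add: field_simps)
qed

text \<open>
  The spectral radius formula in the case needed here. The means of the resolvent over the roots of
  unity of order \<open>N\<close>, which equal \<open>(1 - s\<^sup>N P\<^sup>N)\<^sup>-\<^sup>1\<close>, depend on \<open>s\<close> uniformly continuously, uniformly
  in \<open>N\<close>; hence the set of all \<open>s\<close> with \<open>s\<^sup>N P\<^sup>N \<longlonglongrightarrow> 0\<close> can be enlarged in steps of fixed length.
\<close>

lemma quasinilpotent_scaled_powers_tendsto_zero:
  fixes P :: "'a::{complex_banach, perfect_space} cop"
  assumes inv: "\<And>w. cop_invertible (1 - w *\<^sub>C P)" and \<rho>: "0 \<le> \<rho>"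
  shows "(\<lambda>N. \<rho> ^ N *\<^sub>R P ^ N) \<longlonglongrightarrow> 0"
proof -
  let ?R = "\<lambda>w. cop_inverse (1 - w *\<^sub>C P)"
  \<comment> \<open>The extra radius 1 leaves room for parameters slightly beyond
    \<open>\<rho>\<close>.\<close>
  let ?D = "cball (0::complex) (\<rho> + 1)"
  have "uniformly_continuous_on ?D ?R"
    by (rule compact_uniformly_continuous[OF continuous_resolvent[OF inv] compact_cball])
  then obtain d where d: "d > 0"
    and dR: "\<And>v w. v \<in> ?D \<Longrightarrow> w \<in> ?D \<Longrightarrow> dist w v < d \<Longrightarrow> dist (?R w) (?R v) < 1 / 4"
    unfolding uniformly_continuous_on_def by (metis zero_less_divide_1_iff zero_less_numeral)
  have "bounded (?R ` ?D)"
    by (rule compact_imp_bounded[OF compact_continuous_image[OF continuous_resolvent[OF inv] compact_cball]])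
  then obtain K where "\<forall>y\<in>?R ` ?D. norm y \<le> K"
    unfolding bounded_iff by blast
  then have K: "norm (?R w) \<le> K" if "w \<in> ?D" for w
    using that by blast
  define \<delta> where "\<delta> = min d 1"
  have \<delta>: "\<delta> > 0" "\<delta> \<le> d" "\<delta> \<le> 1" using d by (auto simp: \<delta>_def)
  define g where "g N s = (\<Sum>\<omega> | \<omega> ^ N = 1. ?R (\<omega> * of_real s)) /\<^sub>R real N" for N and s :: real
  have in_D: "\<omega> * of_real s \<in> ?D" if "\<omega> ^ N = 1" "N > 0" "0 \<le> s" "s \<le> \<rho> + 1" for \<omega> s N
    using that norm_root_unity[OF that(1,2)] by (simp add: norm_mult)
  have gP: "g N s * (1 - s ^ N *\<^sub>R P ^ N) = 1" if "N > 0" for N s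
    using mean_resolvent_roots_unity[OF inv that, of "of_real s"]
    by (simp add: g_def scaleC_of_real flip: of_real_power)
  have gK: "norm (g N s) \<le> K" if "N > 0" "0 \<le> s" "s \<le> \<rho> + 1" for N s
    unfolding g_def by (rule norm_mean_le) (use that in \<open>auto intro!: K in_D\<close>)
  have g_diff: "norm (g N s - g N t) \<le> 1 / 4"
    if "N > 0" "0 \<le> s" "s \<le> \<rho> + 1" "0 \<le> t" "t \<le> \<rho> + 1" "\<bar>s - t\<bar> < d" for N s t
  proof -
    have "g N s - g N t = (\<Sum>\<omega> | \<omega> ^ N = 1. ?R (\<omega> * of_real s) - ?R (\<omega> * of_real t)) /\<^sub>R real N"
      by (simp add: g_def sum_subtractf scaleR_diff_right)
    also have "norm \<dots> \<le> 1 / 4"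
    proof (rule norm_mean_le[OF that(1)])
      fix \<omega> :: complex assume w: "\<omega> ^ N = 1"
      have "dist (\<omega> * of_real s) (\<omega> * of_real t) = cmod \<omega> * \<bar>s - t\<bar>"
        by (simp add: dist_norm norm_mult flip: right_diff_distrib of_real_diff)
      then have "dist (\<omega> * of_real s) (\<omega> * of_real t) < d"
        using norm_root_unity[OF w that(1)] that by simp
      from dR[OF in_D[OF w that(1,4,5)] in_D[OF w that(1,2,3)] this]
      show "norm (?R (\<omega> * of_real s) - ?R (\<omega> * of_real t)) \<le> 1 / 4"
        by (simp add: dist_norm)
    qed
    finally show ?thesis .
  qed
  \<comment> \<open>If the powers scaled by \<open>r\<close> tend to 0, then \<open>g N t\<close> is
    eventually within \<open>1 / 2\<close> of 1. This bounds the powers scaled by \<open>t\<close>,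
    and any smaller \<open>s\<close> gains the decaying factor \<open>(s / t) ^ N\<close>.\<close>
  have step: "(\<lambda>N. s ^ N *\<^sub>R P ^ N) \<longlonglongrightarrow> 0"
    if s: "0 \<le> s" "s < t" "t \<le> \<rho> + 1" and r: "0 \<le> r" "r \<le> \<rho> + 1" "\<bar>t - r\<bar> < d"
      and lim: "(\<lambda>N. r ^ N *\<^sub>R P ^ N) \<longlonglongrightarrow> 0" for r s t
  proof -
    have "\<forall>\<^sub>F N in sequentially. norm (r ^ N *\<^sub>R P ^ N) < 1 / (4 * (\<bar>K\<bar> + 1))"
      using lim by (intro order_tendstoD(2)[OF tendsto_norm_zero]) auto
    then have bnd: "\<forall>\<^sub>F N in sequentially. norm (t ^ N *\<^sub>R P ^ N) \<le> 3"
      using eventually_gt_at_top[of 0]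
    proof eventually_elim
      case (elim N)
      let ?Y = "t ^ N *\<^sub>R P ^ N"
      have "g N r - 1 = g N r * (r ^ N *\<^sub>R P ^ N)"
        using gP[OF elim(2), of r] by (simp add: right_diff_distrib algebra_simps)
      then have "norm (g N r - 1) \<le> norm (g N r) * norm (r ^ N *\<^sub>R P ^ N)"
        by (simp only: norm_mult_ineq)
      also have "\<dots> \<le> (\<bar>K\<bar> + 1) * (1 / (4 * (\<bar>K\<bar> + 1)))"
        using elim gK[OF elim(2) r(1,2)] by (intro mult_mono) auto
      also have "\<dots> = 1 / 4" by simp
      finally have "norm (g N r - 1) \<le> 1 / 4" .
      moreover have "norm (g N t - g N r) \<le> 1 / 4"
        using g_diff[OF elim(2), of t r] s r by simp
      moreover have "norm (g N t - 1) \<le> norm (g N t - g N r) + norm (g N r - 1)"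
        using norm_triangle_ineq[of "g N t - g N r" "g N r - 1"] by simp
      ultimately have g1: "norm (1 - g N t) \<le> 1 / 2" by (simp add: norm_minus_commute)
      \<comment> \<open>The last term has at most half the norm of \<open>1 - ?Y\<close> and is
        absorbed.\<close>
      have "1 - ?Y = 1 + (1 - g N t) * (1 - ?Y)"
        using gP[OF elim(2), of t] by (simp add: left_diff_distrib)
      then have "norm (1 - ?Y) = norm (1 + (1 - g N t) * (1 - ?Y))" by (rule arg_cong)
      also have "\<dots> \<le> norm (1 :: 'a cop) + norm ((1 - g N t) * (1 - ?Y))" by (rule norm_triangle_ineq)
      also have "norm ((1 - g N t) * (1 - ?Y)) \<le> 1 / 2 * norm (1 - ?Y)"
        by (rule order_trans[OF norm_mult_ineq mult_right_mono[OF g1 norm_ge_zero]])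
      finally have "norm (1 - ?Y) \<le> 2" by simp
      moreover have "norm ?Y \<le> 1 + norm (1 - ?Y)"
        using norm_triangle_ineq4[of "1 :: 'a cop" "1 - ?Y"] by simp
      ultimately show "norm ?Y \<le> 3" by simp
    qed
    have "(\<lambda>N. (s / t) ^ N * 3) \<longlonglongrightarrow> 0"
      using s by (intro tendsto_mult_left_zero LIMSEQ_power_zero) simp
    then show ?thesis
    proof (rule Lim_null_comparison[rotated])
      show "\<forall>\<^sub>F N in sequentially. norm (s ^ N *\<^sub>R P ^ N) \<le> (s / t) ^ N * 3"
        using bnd
      proof eventually_elim
        case (elim N)
        have "norm (s ^ N *\<^sub>R P ^ N) = (s / t) ^ N * norm (t ^ N *\<^sub>R P ^ N)"
          using s by (simp add: power_divide)
        also have "\<dots> \<le> (s / t) ^ N * 3"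
          using s elim by (intro mult_left_mono) auto
        finally show ?case .
      qed
    qed
  qed
  have "(\<lambda>N. s ^ N *\<^sub>R P ^ N) \<longlonglongrightarrow> 0" if "0 \<le> s" "s \<le> \<rho>" "s \<le> real n * (\<delta> / 2)" for n s
    using that
  proof (induction n arbitrary: s)
    case 0
    then have "s = 0" by simp
    \<comment> \<open>The term at \<open>N = 0\<close> is 1 even for \<open>s = 0\<close>, so the
      sequence vanishes only from \<open>N = 1\<close> on.\<close>
    have "\<forall>\<^sub>F N in sequentially. s ^ N *\<^sub>R P ^ N = 0"
      using eventually_gt_at_top[of 0] by eventually_elim (simp add: \<open>s = 0\<close>)
    then show ?case by (rule tendsto_eventually)
  next
    case (Suc n)
    \<comment> \<open>With \<open>t = s + \<delta> / 4\<close> the distance from \<open>r\<close> to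
      \<open>t\<close> is at most \<open>3 * \<delta> / 4\<close>, hence below
      \<open>d\<close>.\<close>
    define r where "r = max 0 (s - \<delta> / 2)"
    have "s - \<delta> / 2 \<le> real n * (\<delta> / 2)" using Suc.prems by (simp add: field_simps)
    moreover have "0 \<le> real n * (\<delta> / 2)" using \<delta> by simp
    ultimately have "r \<le> real n * (\<delta> / 2)" unfolding r_def by (rule max.boundedI[rotated])
    moreover have "0 \<le> r" "r \<le> \<rho>" using Suc.prems \<rho> \<delta> by (auto simp: r_def)
    ultimately have "(\<lambda>N. r ^ N *\<^sub>R P ^ N) \<longlonglongrightarrow> 0" by (intro Suc.IH)
    then show ?case
      using Suc.prems \<delta> \<rho> by (intro step[of s "s + \<delta> / 4" r]) (auto simp: r_def max_def abs_if)
  qed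
  moreover obtain n where "\<rho> \<le> real n * (\<delta> / 2)"
    using ex_less_of_nat_mult[of "\<delta> / 2" \<rho>] \<delta> less_imp_le by auto
  ultimately show ?thesis using \<rho> by blast
qed

lemma exp_square_zero:
  fixes X :: "'a::{real_normed_algebra_1, banach}"
  assumes "X * X = 0"
  shows "exp X = 1 + X"
proof -
  have "(\<lambda>n. X ^ n /\<^sub>R fact n) sums (\<Sum>n\<in>{0,1}. X ^ n /\<^sub>R fact n)"
  proof (rule sums_finite)
    fix n :: nat assume "n \<notin> {0, 1}"
    then have "2 \<le> n" by simp
    then obtain m where "n = 2 + m" by (auto simp: le_iff_add)
    then have "X ^ n = (X * X) * X ^ m" by (simp add: mult.assoc)
    then show "X ^ n /\<^sub>R fact n = 0" using assms by simp
  qed simp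
  then show ?thesis using sums_unique2[OF exp_converges] by fastforce
qed

text \<open>Here \<open>exp (t *\<^sub>R B) = 1 + t *\<^sub>R B\<close> grows linearly unless
  \<open>B = 0\<close>.\<close>

lemma square_zero_bounded_semigroup:
  fixes B :: "'a::{real_normed_algebra_1, banach}"
  assumes B: "B * B = 0" and M: "\<And>t. 0 \<le> t \<Longrightarrow> norm (exp (t *\<^sub>R B)) \<le> M"
  shows "B = 0"
proof (rule ccontr)
  assume "B \<noteq> 0"
  then have nB: "norm B > 0" by simp
  define t where "t = (\<bar>M\<bar> + 2) / norm B"
  have "exp (t *\<^sub>R B) = 1 + t *\<^sub>R B" using B by (intro exp_square_zero) simp
  then have "norm (1 + t *\<^sub>R B) \<le> M" using M[of t] nB by (simp add: t_def)
  then have "norm (t *\<^sub>R B) \<le> M + 1"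
    using norm_triangle_ineq4[of "1 + t *\<^sub>R B" 1] by simp
  then show False using nB by (simp add: t_def)
qed

text \<open>
  The weights \<open>\<omega>\<^sup>-\<^sup>2 - 1\<close> compensate the growth of the resolvent near the real axis and turn the means
  over roots of unity into a uniform bound for \<open>1 - s\<^sup>2 P\<^sup>2\<close>.
\<close>

lemma quasinilpotent_bounded_group_eq_0:
  fixes P :: "'a::{complex_banach, perfect_space} cop"
  assumes inv: "\<And>w. cop_invertible (1 - w *\<^sub>C P)"
    and M1: "\<And>t. 0 \<le> t \<Longrightarrow> norm (exp (t *\<^sub>R (\<i> *\<^sub>C P))) \<le> M"
    and M2: "\<And>t. 0 \<le> t \<Longrightarrow> norm (exp (t *\<^sub>R ((- \<i>) *\<^sub>C P))) \<le> M"
  shows "P = 0"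
proof -
  let ?R = "\<lambda>w. cop_inverse (1 - w *\<^sub>C P)"
  have M0: "0 \<le> M" by (rule order_trans[OF norm_ge_zero M1[OF order_refl]])
  have R_le: "\<bar>Im w\<bar> * norm (?R w) \<le> M * cmod w" for w
  proof (cases "Im w = 0")
    case False
    then have w: "w \<noteq> 0" by auto
    \<comment> \<open>The sign selects which of the two semigroups gives a positive real part for
      the resolvent at \<open>w\<close>.\<close>
    define \<sigma> where "\<sigma> = sgn (Im w)"
    have \<sigma>: "\<sigma> = 1 \<or> \<sigma> = - 1" "\<sigma> * Im w = \<bar>Im w\<bar>"
      using False by (auto simp: \<sigma>_def sgn_if)
    have Re: "Re (of_real \<sigma> * \<i> / w) = \<bar>Im w\<bar> / (cmod w)\<^sup>2"
      using \<sigma> by (simp add: Re_divide cmod_power2)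
    have "norm (exp (t *\<^sub>R ((of_real \<sigma> * \<i>) *\<^sub>C P))) \<le> M" if "0 \<le> t" for t
      using \<sigma>(1) M1[OF that] M2[OF that] by auto
    from resolvent_bound_direction[OF this w _ inv] False w
    have "norm (?R w) \<le> cmod (of_real \<sigma> * \<i> / w) * (M / (\<bar>Im w\<bar> / (cmod w)\<^sup>2))"
      unfolding Re by simp
    also have "\<dots> = M * cmod w / \<bar>Im w\<bar>"
      using \<sigma>(1) w by (auto simp: norm_divide norm_mult power2_eq_square)
    finally show ?thesis using False by (simp add: pos_le_divide_eq mult.commute)
  qed (use M0 in simp)
  have le: "norm (s\<^sup>2 *\<^sub>R P\<^sup>2 - 1) \<le> 2 * M" if s: "s > 0" for s
  proof -
    have le_N: "norm (s\<^sup>2 *\<^sub>R P\<^sup>2 - 1) \<le> 2 * M * norm (1 - s ^ N *\<^sub>R P ^ N)" if N: "N > 2" for N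
    proof -
      define V where "V = 1 - (of_real s) ^ N *\<^sub>C P ^ N"
      have V: "V = 1 - s ^ N *\<^sub>R P ^ N" by (simp add: V_def scaleC_of_real flip: of_real_power)
      define W where "W = (\<Sum>\<omega> | \<omega> ^ N = 1. (\<omega> ^ (N - 2) - \<omega> ^ (N - 0)) *\<^sub>C ?R (\<omega> * of_real s)) /\<^sub>R real N"
      have "W * V = ((of_nat N * (of_real s)\<^sup>2) *\<^sub>C P\<^sup>2 - (of_nat N * (of_real s) ^ 0) *\<^sub>C P ^ 0) /\<^sub>R real N"
        unfolding W_def V_def scaleC_diff_left sum_subtractf
          mult_scaleR_left left_diff_distrib
        using N by (subst (1 2) sum_roots_unity_resolvent[OF inv]) auto
      also have "\<dots> = s\<^sup>2 *\<^sub>R P\<^sup>2 - 1"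
        using N by (simp add: scaleC_of_nat scaleC_of_real scaleR_diff_right
            flip: scaleC_scaleC of_real_power)
      finally have WV: "s\<^sup>2 *\<^sub>R P\<^sup>2 - 1 = W * V" by simp
      have "norm W \<le> 2 * M"
        unfolding W_def
      proof (rule norm_mean_le)
        fix \<omega> :: complex assume \<omega>: "\<omega> ^ N = 1"
        have n1: "cmod \<omega> = 1" using norm_root_unity[OF \<omega>] N by simp
        \<comment> \<open>This computation shows that the weight has modulus
          \<open>2 * \<bar>Im \<omega>\<bar>\<close>, exactly the factor needed in
          \<open>R_le\<close>.\<close>
        have "\<omega>\<^sup>2 * (\<omega> ^ (N - 2) - \<omega> ^ (N - 0)) = \<omega> ^ N - \<omega>\<^sup>2 * \<omega> ^ N"
        proof -
          have "\<omega>\<^sup>2 * \<omega> ^ (N - 2) = \<omega> ^ N"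
            using N by (metis le_add_diff_inverse less_imp_le_nat power_add)
          then show ?thesis by (simp add: right_diff_distrib)
        qed
        also have "\<dots> = \<omega> * (cnj \<omega> - \<omega>)"
          using \<omega> n1 complex_norm_square[of \<omega>] by (simp add: right_diff_distrib power2_eq_square)
        finally have "cmod (\<omega>\<^sup>2) * cmod (\<omega> ^ (N - 2) - \<omega> ^ (N - 0)) = cmod \<omega> * cmod (cnj \<omega> - \<omega>)"
          by (simp only: flip: norm_mult)
        moreover have "cmod (cnj \<omega> - \<omega>) = 2 * \<bar>Im \<omega>\<bar>"
        proof -
          have "cnj \<omega> - \<omega> = of_real (- 2 * Im \<omega>) * \<i>" by (simp add: complex_eq_iff)
          then show ?thesis by (simp add: norm_mult)
        qed
        ultimately have "norm ((\<omega> ^ (N - 2) - \<omega> ^ (N - 0)) *\<^sub>C ?R (\<omega> * of_real s))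
            = 2 * \<bar>Im \<omega>\<bar> * norm (?R (\<omega> * of_real s))"
          by (simp add: norm_scaleC norm_power n1)
        also have "\<dots> = 2 * (\<bar>Im (\<omega> * of_real s)\<bar> * norm (?R (\<omega> * of_real s))) / s"
          using s by (simp add: abs_mult)
        also have "\<dots> \<le> 2 * (M * cmod (\<omega> * of_real s)) / s"
          using s by (intro divide_right_mono mult_left_mono R_le) auto
        also have "\<dots> = 2 * M" using s n1 by (simp add: norm_mult)
        finally show "norm ((\<omega> ^ (N - 2) - \<omega> ^ (N - 0)) *\<^sub>C ?R (\<omega> * of_real s)) \<le> 2 * M" .
      qed (use N in simp)
      then have "norm (W * V) \<le> 2 * M * norm V"
        by (intro order_trans[OF norm_mult_ineq] mult_right_mono) auto
      then show ?thesis unfolding WV V .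
    qed
    \<comment> \<open>As \<open>N\<close> grows the scaled powers disappear, leaving a bound
      independent of \<open>s\<close>.\<close>
    have "(\<lambda>N. 2 * M * norm (1 - s ^ N *\<^sub>R P ^ N)) \<longlonglongrightarrow> 2 * M * norm (1 - 0 :: 'a cop)"
      using quasinilpotent_scaled_powers_tendsto_zero[OF inv, of s] s by (intro tendsto_intros) auto
    moreover have "\<forall>\<^sub>F N in sequentially. norm (s\<^sup>2 *\<^sub>R P\<^sup>2 - 1) \<le> 2 * M * norm (1 - s ^ N *\<^sub>R P ^ N)"
      using eventually_gt_at_top[of 2] by eventually_elim (rule le_N)
    ultimately have "norm (s\<^sup>2 *\<^sub>R P\<^sup>2 - 1) \<le> 2 * M * norm (1 - 0 :: 'a cop)"
      by (rule tendsto_lowerbound) simp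
    then show ?thesis by simp
  qed
  have "P\<^sup>2 = 0"
  proof (rule ccontr)
    assume "P\<^sup>2 \<noteq> 0"
    then have nP: "norm (P\<^sup>2) > 0" by simp
    \<comment> \<open>Makes \<open>s\<^sup>2 * norm (P\<^sup>2)\<close> equal to
      \<open>2 * M + 2\<close>, just above the permitted \<open>2 * M + 1\<close>.\<close>
    define s where "s = sqrt ((2 * M + 2) / norm (P\<^sup>2))"
    have s: "s > 0" "s\<^sup>2 = (2 * M + 2) / norm (P\<^sup>2)" using nP M0 by (auto simp: s_def)
    have "norm (s\<^sup>2 *\<^sub>R P\<^sup>2) \<le> norm (s\<^sup>2 *\<^sub>R P\<^sup>2 - 1) + norm (1 :: 'a cop)"
      using norm_triangle_ineq[of "s\<^sup>2 *\<^sub>R P\<^sup>2 - 1" 1] by simp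
    then have "s\<^sup>2 * norm (P\<^sup>2) \<le> 2 * M + 1" using le[OF s(1)] by simp
    then show False unfolding s(2) using nP by simp
  qed
  then have "(\<i> *\<^sub>C P) * (\<i> *\<^sub>C P) = 0" by (simp add: power2_eq_square)
  from square_zero_bounded_semigroup[OF this M1] have "\<i> *\<^sub>C P = 0" by simp
  then have "norm (\<i> *\<^sub>C P) = 0" by simp
  then show ?thesis by (simp add: norm_scaleC)
qed

section \<open>Positive operators\<close>

context complex_function_space
begin

section \<open>Conjugation, moduli and positive vectors\<close>

lemma ev_eqI: "(\<And>w. ev x w = ev y w) \<Longrightarrow> x = y"
  by (rule injD[OF ev_inj], rule ext)

lemma ev_scaleR: "ev (r *\<^sub>R x) w = of_real r * ev x w"
  using ev_scaleC[of "of_real r"] by (simp add: scaleC_of_real)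

lemma ev_diff: "ev (x - y) w = ev x w - ev y w"
  using ev_add[of "x - y" y w] by simp

lemma ev_zero: "ev 0 w = 0"
  using ev_diff[of 0 0 w] by simp

text \<open>The axioms place the conjugated function in \<open>range ev\<close>;
  \<open>inv ev\<close> picks its preimage, unique since \<open>ev\<close> is injective.\<close>

definition conj_vec :: "'a \<Rightarrow> 'a" where
  "conj_vec x = inv ev (\<lambda>w. cnj (ev x w))"

definition abs_vec :: "'a \<Rightarrow> 'a" where
  "abs_vec x = inv ev (\<lambda>w. complex_of_real (cmod (ev x w)))"

lemma ev_conj_vec: "ev (conj_vec x) w = cnj (ev x w)"
  unfolding conj_vec_def using cnj_mem_iff[of "ev x"] by (simp add: f_inv_into_f)

lemma ev_abs_vec: "ev (abs_vec x) w = complex_of_real (cmod (ev x w))"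
  unfolding abs_vec_def using abs_mem_iff[of "ev x"] by (simp add: f_inv_into_f)

lemmas ev_simps = ev_add ev_scaleC ev_scaleR ev_diff ev_zero ev_conj_vec ev_abs_vec

lemma norm_conj_vec: "norm (conj_vec x) = norm x"
  by (rule norm_cnj) (auto simp: ev_conj_vec)

lemma conj_conj_vec: "conj_vec (conj_vec x) = x"
  by (rule ev_eqI) (simp add: ev_conj_vec)

lemma conj_vec_add: "conj_vec (x + y) = conj_vec x + conj_vec y"
  by (rule ev_eqI) (simp add: ev_simps)

lemma conj_vec_diff: "conj_vec (x - y) = conj_vec x - conj_vec y"
  by (rule ev_eqI) (simp add: ev_simps)

lemma conj_vec_scaleC: "conj_vec (c *\<^sub>C x) = cnj c *\<^sub>C conj_vec x"
  by (rule ev_eqI) (simp add: ev_simps)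

lemma conj_vec_scaleR: "conj_vec (r *\<^sub>R x) = r *\<^sub>R conj_vec x"
  by (rule ev_eqI) (simp add: ev_simps)

lemma bounded_linear_conj_vec: "bounded_linear conj_vec"
  by (rule bounded_linear_intro[where K = 1])
    (simp_all add: conj_vec_add conj_vec_scaleR norm_conj_vec)

lemma conj_vec_positive: "positive_vector ev x \<Longrightarrow> conj_vec x = x"
  by (rule ev_eqI) (auto simp: ev_conj_vec positive_vector_def Reals_cnj_iff)

lemma positive_vector_zero: "positive_vector ev 0"
  by (simp add: positive_vector_def ev_zero)

lemma positive_vector_add: "positive_vector ev x \<Longrightarrow> positive_vector ev y \<Longrightarrow> positive_vector ev (x + y)"
  by (simp add: positive_vector_def ev_add)

lemma positive_vector_scaleR: "positive_vector ev x \<Longrightarrow> 0 \<le> r \<Longrightarrow> positive_vector ev (r *\<^sub>R x)"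
  by (simp add: positive_vector_def ev_scaleR)

lemma positive_vector_sum: "(\<And>i. i \<in> I \<Longrightarrow> positive_vector ev (f i)) \<Longrightarrow> positive_vector ev (\<Sum>i\<in>I. f i)"
  by (induction I rule: infinite_finite_induct)
    (simp_all add: positive_vector_zero positive_vector_add)

lemma norm_le_add_positive:
  assumes "positive_vector ev x" "positive_vector ev y"
  shows "norm x \<le> norm (x + y)"
  by (rule norm_mono) (use assms in \<open>auto simp: positive_vector_def ev_add\<close>)

text \<open>The positive and negative parts are half the sum and half the difference of
  \<open>abs_vec x\<close> and \<open>x\<close>.\<close>

lemma real_vector_decomposition:
  assumes "\<And>w. ev x w \<in> \<real>"
  obtains a b where "positive_vector ev a" "positive_vector ev b" "x = a - b"
proof
  define g where "g w = Re (ev x w)" for w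
  have x: "ev x w = complex_of_real (g w)" for w
    unfolding g_def using of_real_Re[OF assms[of w]] by (rule sym)
  have "ev ((1 / 2) *\<^sub>R (abs_vec x + x)) w = of_real ((\<bar>g w\<bar> + g w) / 2)"
    and "ev ((1 / 2) *\<^sub>R (abs_vec x - x)) w = of_real ((\<bar>g w\<bar> - g w) / 2)" for w
    by (simp_all add: ev_simps x)
  moreover have "0 \<le> \<bar>g w\<bar> + g w" "g w \<le> \<bar>g w\<bar>" for w
    by (auto simp: abs_if)
  ultimately show "positive_vector ev ((1 / 2) *\<^sub>R (abs_vec x + x))"
    "positive_vector ev ((1 / 2) *\<^sub>R (abs_vec x - x))"
    by (simp_all add: positive_vector_def del: of_real_divide of_real_add of_real_diff)
  show "x = (1 / 2) *\<^sub>R (abs_vec x + x) - (1 / 2) *\<^sub>R (abs_vec x - x)"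
    by (simp flip: scaleR_diff_right)
qed

lemma positive_decomposition:
  obtains a b c d where "positive_vector ev a" "positive_vector ev b"
    "positive_vector ev c" "positive_vector ev d" "x = (a - b) + \<i> *\<^sub>C (c - d)"
proof -
  define r s where "r = (1 / 2) *\<^sub>R (x + conj_vec x)" and "s = (- \<i> / 2) *\<^sub>C (x - conj_vec x)"
  have r: "ev r w = of_real (Re (ev x w))" and s: "ev s w = of_real (Im (ev x w))" for w
    by (auto simp: r_def s_def ev_simps complex_eq_iff)
  obtain a b where "positive_vector ev a" "positive_vector ev b" "r = a - b"
    by (rule real_vector_decomposition[of r]) (auto simp: r)
  moreover obtain c d where "positive_vector ev c" "positive_vector ev d" "s = c - d"
    by (rule real_vector_decomposition[of s]) (auto simp: s)
  moreover have "x = r + \<i> *\<^sub>C s"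
    by (rule ev_eqI) (simp add: ev_simps r s complex_eq_iff)
  ultimately show ?thesis by (intro that) auto
qed

lemma cop_eq_0_positive:
  assumes "\<And>x. positive_vector ev x \<Longrightarrow> cop_apply T x = 0"
  shows "T = 0"
proof (rule cop_eqI)
  fix x
  show "cop_apply T x = cop_apply 0 x"
    by (rule positive_decomposition[of x]) (simp add: assms)
qed

text \<open>Positive vectors and their images are fixed by conjugation; the decomposition into four
  positive vectors extends this to all of the space.\<close>

lemma positive_real_op_conj_vec:
  assumes P: "positive_real_op ev P"
  shows "cop_apply P (conj_vec x) = conj_vec (cop_apply P x)"
proof (rule positive_decomposition[of x])
  fix a b c d
  assume "positive_vector ev a" "positive_vector ev b" "positive_vector ev c" "positive_vector ev d"
    and x: "x = (a - b) + \<i> *\<^sub>C (c - d)"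
  moreover have "conj_vec y = y" "conj_vec (cop_apply P y) = cop_apply P y"
    if "positive_vector ev y" for y
    using that P by (simp_all only: positive_real_op_def conj_vec_positive)
  ultimately show ?thesis
    by (simp add: x conj_vec_add conj_vec_diff conj_vec_scaleC)
qed

text \<open>Says that \<open>T\<close> is \<open>S\<close> conjugated by the antilinear isometric
  involution \<open>conj_vec\<close>. As a relation it passes through sums, products and series
  without constructing the conjugate operator.\<close>

definition conj_related :: "'a cop \<Rightarrow> 'a cop \<Rightarrow> bool" where
  "conj_related S T \<longleftrightarrow> (\<forall>x. cop_apply T (conj_vec x) = conj_vec (cop_apply S x))"

lemma norm_conj_related:
  assumes "conj_related S T"
  shows "norm T \<le> norm S"
proof (rule norm_cop_le)
  fix x
  have "cop_apply T (conj_vec (conj_vec x)) = conj_vec (cop_apply S (conj_vec x))"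
    using assms by (simp only: conj_related_def)
  then have "cop_apply T x = conj_vec (cop_apply S (conj_vec x))"
    by (simp only: conj_conj_vec)
  then show "norm (cop_apply T x) \<le> norm S * norm x"
    using norm_cop_apply[of S "conj_vec x"] by (simp add: norm_conj_vec)
qed simp

lemma conj_related_positive_scaleC:
  "positive_real_op ev P \<Longrightarrow> conj_related (c *\<^sub>C P) (cnj c *\<^sub>C P)"
  by (simp add: conj_related_def cop_apply_scaleC conj_vec_scaleC positive_real_op_conj_vec)

lemma conj_related_add: "conj_related S T \<Longrightarrow> conj_related S' T' \<Longrightarrow> conj_related (S + S') (T + T')"
  by (simp add: conj_related_def conj_vec_add)

lemma conj_related_mult: "conj_related S T \<Longrightarrow> conj_related S' T' \<Longrightarrow> conj_related (S * S') (T * T')"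
  by (simp add: conj_related_def)

lemma conj_related_scaleR: "conj_related S T \<Longrightarrow> conj_related (r *\<^sub>R S) (r *\<^sub>R T)"
  by (simp add: conj_related_def conj_vec_scaleR)

end

text \<open>The sort \<open>perfect_space\<close> excludes the zero space and thereby provides the
  unit, powers and exponentials of operators.\<close>

locale regular_complex_function_space = complex_function_space ev
  for ev :: "'a::{complex_banach, perfect_space} \<Rightarrow> 'w \<Rightarrow> complex"
begin

lemma conj_related_one: "conj_related 1 1"
  by (simp add: conj_related_def)

lemma conj_related_power: "conj_related S T \<Longrightarrow> conj_related (S ^ n) (T ^ n)"
  by (induction n) (simp_all add: conj_related_one conj_related_mult)

lemma sums_exp_cop_apply: "(\<lambda>n. cop_apply (T ^ n /\<^sub>R fact n) x) sums cop_apply (exp T) x"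
  by (rule bounded_linear.sums[OF bounded_linear_cop_apply exp_converges])

text \<open>Conjugation is bounded and real linear, so it passes through the exponential series term
  by term.\<close>

lemma conj_related_exp:
  assumes "conj_related S T"
  shows "conj_related (exp S) (exp T)"
  unfolding conj_related_def
proof
  fix x
  have "(\<lambda>n. conj_vec (cop_apply (S ^ n /\<^sub>R fact n) x)) sums conj_vec (cop_apply (exp S) x)"
    by (rule bounded_linear.sums[OF bounded_linear_conj_vec sums_exp_cop_apply])
  also have "(\<lambda>n. conj_vec (cop_apply (S ^ n /\<^sub>R fact n) x)) = (\<lambda>n. cop_apply (T ^ n /\<^sub>R fact n) (conj_vec x))"
    using conj_related_scaleR[OF conj_related_power[OF assms]] unfolding conj_related_def by metis
  finally show "cop_apply (exp T) (conj_vec x) = conj_vec (cop_apply (exp S) x)"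
    using sums_exp_cop_apply sums_unique2 by blast
qed

lemma positive_power:
  "positive_real_op ev X \<Longrightarrow> positive_vector ev x \<Longrightarrow> positive_vector ev (cop_apply (X ^ n) x)"
  by (induction n) (simp_all add: positive_real_op_def)

text \<open>All terms of the exponential series at \<open>x\<close> are positive, so every partial
  sum containing the linear term dominates it in norm.\<close>

lemma norm_positive_le_exp:
  assumes X: "positive_real_op ev X" and x: "positive_vector ev x"
  shows "norm (cop_apply X x) \<le> norm (cop_apply (exp X) x)"
proof -
  let ?f = "\<lambda>n. cop_apply (X ^ n /\<^sub>R fact n) x"
  have pos: "positive_vector ev (?f n)" for n
    using positive_power[OF X x] by (simp add: positive_vector_scaleR)
  have "(\<lambda>N. norm (\<Sum>n<N. ?f n)) \<longlonglongrightarrow> norm (cop_apply (exp X) x)"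
    using sums_exp_cop_apply unfolding sums_def by (rule tendsto_norm)
  moreover have "norm (cop_apply X x) \<le> norm (\<Sum>n<N. ?f n)" if "N \<ge> 2" for N
  proof -
    have "(\<Sum>n<N. ?f n) = ?f 1 + (\<Sum>n\<in>{..<N} - {1}. ?f n)"
      using that by (intro sum.remove) auto
    moreover have "norm (?f 1) \<le> norm (?f 1 + (\<Sum>n\<in>{..<N} - {1}. ?f n))"
      by (intro norm_le_add_positive positive_vector_sum pos)
    ultimately show ?thesis by simp
  qed
  ultimately show ?thesis using LIMSEQ_le_const by blast
qed

lemma norm_le_power_one_plus_positive:
  assumes V: "positive_real_op ev V" and x: "positive_vector ev x"
  shows "norm x \<le> norm (cop_apply ((1 + V) ^ n) x)"
proof -
  have "\<exists>p. positive_vector ev p \<and> cop_apply ((1 + V) ^ n) x = x + p"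
  proof (induction n)
    case 0
    then show ?case using positive_vector_zero by (intro exI[of _ 0]) simp
  next
    case (Suc n)
    then obtain p where p: "positive_vector ev p" "cop_apply ((1 + V) ^ n) x = x + p" by blast
    have "cop_apply ((1 + V) ^ Suc n) x = x + (p + cop_apply V (x + p))"
      by (simp add: p(2))
    moreover have "positive_vector ev (p + cop_apply V (x + p))"
      using V x p by (simp only: positive_vector_add positive_real_op_def)
    ultimately show ?case by blast
  qed
  then show ?thesis using norm_le_add_positive[OF x] by metis
qed

lemma positive_bounded_semigroup_eq_0:
  assumes P: "positive_real_op ev P"
    and M: "\<And>t. 0 \<le> t \<Longrightarrow> norm (exp (t *\<^sub>R P)) \<le> M"
  shows "P = 0"
proof (rule cop_eq_0_positive)
  fix x assume x: "positive_vector ev x"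
  have le: "t * norm (cop_apply P x) \<le> M * norm x" if t: "0 \<le> t" for t
  proof -
    have "positive_real_op ev (t *\<^sub>R P)"
      using P t by (simp add: positive_real_op_def positive_vector_scaleR)
    from norm_positive_le_exp[OF this x]
    have "t * norm (cop_apply P x) \<le> norm (cop_apply (exp (t *\<^sub>R P)) x)"
      using t by simp
    also have "\<dots> \<le> norm (exp (t *\<^sub>R P)) * norm x" by (rule norm_cop_apply)
    also have "\<dots> \<le> M * norm x" by (intro mult_right_mono M t) simp
    finally show ?thesis .
  qed
  show "cop_apply P x = 0"
  proof (rule ccontr)
    assume "cop_apply P x \<noteq> 0"
    then have n: "norm (cop_apply P x) > 0" by simp
    have "0 \<le> M * norm x" using le[of 0] by simp
    then show False
      using le[of "(M * norm x + 1) / norm (cop_apply P x)"] n by simp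
  qed
qed

text \<open>Bounded directions are closed under conjugation, sums and nonnegative scaling. If
  \<open>Re \<zeta> \<noteq> 0\<close>, then \<open>\<zeta> + cnj \<zeta>\<close> scales to 1,
  excluded by positivity, or to - 1. Otherwise both imaginary directions are bounded, which forces
  \<open>P = 0\<close>.\<close>

lemma positive_quasinilpotent_bounded_direction:
  assumes P: "positive_real_op ev P" and P0: "P \<noteq> 0"
    and inv: "\<And>w. cop_invertible (1 - w *\<^sub>C P)"
    and \<zeta>: "\<zeta> \<noteq> 0" and M: "\<And>t. 0 \<le> t \<Longrightarrow> norm (exp (t *\<^sub>R (\<zeta> *\<^sub>C P))) \<le> M"
  obtains M' where "\<And>t. 0 \<le> t \<Longrightarrow> norm (exp (t *\<^sub>R ((- 1) *\<^sub>C P))) \<le> M'"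
proof -
  have M': "norm (exp (t *\<^sub>R (cnj \<zeta> *\<^sub>C P))) \<le> M" if "0 \<le> t" for t
    using norm_conj_related[OF conj_related_exp[OF conj_related_scaleR[OF conj_related_positive_scaleC[OF P]]]]
      M[OF that] by (rule order_trans)
  have scale: "norm (exp (t *\<^sub>R ((of_real c * \<xi>) *\<^sub>C P))) \<le> K"
    if "0 \<le> t" "0 \<le> c" and K: "\<And>t. 0 \<le> t \<Longrightarrow> norm (exp (t *\<^sub>R (\<xi> *\<^sub>C P))) \<le> K" for t c \<xi> K
    using K[of "t * c"] that(1,2) by (simp flip: scaleR_scaleC)
  show ?thesis
  proof (cases "Re \<zeta> = 0")
    case True
    define y where "y = Im \<zeta>"
    have \<zeta>_eq: "\<zeta> = of_real y * \<i>" and "y \<noteq> 0"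
      using True \<zeta> by (auto simp: y_def complex_eq_iff)
    then consider "y > 0" | "y < 0" by linarith
    then have "P = 0"
    proof cases
      case 1
      have "of_real (1 / y) * \<zeta> = \<i>" "of_real (1 / y) * cnj \<zeta> = - \<i>"
        using 1 by (simp_all add: \<zeta>_eq)
      then show ?thesis
        using scale[OF _ _ M, of _ "1 / y"] scale[OF _ _ M', of _ "1 / y"] 1
        by (intro quasinilpotent_bounded_group_eq_0[OF inv, of M]) auto
    next
      case 2
      have "of_real (- 1 / y) * \<zeta> = - \<i>" "of_real (- 1 / y) * cnj \<zeta> = \<i>"
        using 2 by (simp_all add: \<zeta>_eq)
      then show ?thesis
        using scale[OF _ _ M, of _ "- 1 / y"] scale[OF _ _ M', of _ "- 1 / y"] 2
        by (intro quasinilpotent_bounded_group_eq_0[OF inv, of M]) auto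
    qed
    with P0 show ?thesis by simp
  next
    case False
    have MM: "norm (exp (t *\<^sub>R ((\<zeta> + cnj \<zeta>) *\<^sub>C P))) \<le> M * M" if "0 \<le> t" for t
    proof -
      have "exp (t *\<^sub>R ((\<zeta> + cnj \<zeta>) *\<^sub>C P)) = exp (t *\<^sub>R (\<zeta> *\<^sub>C P)) * exp (t *\<^sub>R (cnj \<zeta> *\<^sub>C P))"
        unfolding scaleC_add_left scaleR_add_right
        by (rule exp_add_commuting) (simp add: scaleC_scaleC mult.commute scaleC_scaleR_commute)
      also have "norm \<dots> \<le> norm (exp (t *\<^sub>R (\<zeta> *\<^sub>C P))) * norm (exp (t *\<^sub>R (cnj \<zeta> *\<^sub>C P)))"
        by (rule norm_mult_ineq)
      also have "\<dots> \<le> M * M"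
        using M[OF that] M'[OF that] order_trans[OF norm_ge_zero M[OF that]] by (intro mult_mono) auto
      finally show ?thesis .
    qed
    \<comment> \<open>Normalises \<open>\<zeta> + cnj \<zeta>\<close>, which is
      \<open>2 * Re \<zeta>\<close>, to the sign of \<open>Re \<zeta>\<close>.\<close>
    define c where "c = 1 / (2 * \<bar>Re \<zeta>\<bar>)"
    have c: "c > 0" using False by (simp add: c_def)
    have dir: "of_real c * (\<zeta> + cnj \<zeta>) = of_real (sgn (Re \<zeta>))"
      using False by (simp add: c_def complex_eq_iff sgn_if)
    have bnd: "norm (exp (t *\<^sub>R (of_real (sgn (Re \<zeta>)) *\<^sub>C P))) \<le> M * M" if "0 \<le> t" for t
      using scale[OF that less_imp_le[OF c] MM] unfolding dir .
    show ?thesis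
    proof (cases "Re \<zeta> > 0")
      case True
      then have "P = 0"
        using bnd by (intro positive_bounded_semigroup_eq_0[OF P, of "M * M"]) simp
      with P0 show ?thesis by simp
    next
      case neg: False
      then show ?thesis using bnd False by (intro that[of "M * M"]) simp
    qed
  qed
qed

text \<open>The conjugate \<open>S'\<close> of \<open>S\<close> obeys the same estimate, and two
  factors of order \<open>1 / 2\<close> give decay like \<open>1 / (j + 1)\<close>. If
  \<open>Re z \<ge> 0\<close>, then \<open>S' * S = 1 + V\<close> with \<open>V\<close> positive, so
  the product applied to a positive \<open>u\<close> dominates a fixed multiple of
  \<open>P * P\<close> applied to \<open>u\<close>, which must vanish.\<close>

lemma sqrt_decay_imp_Re_negative:
  assumes P: "positive_real_op ev P" and P2: "P * P \<noteq> 0"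
    and T: "z \<in> T_set (1 / 2) P" and z: "z \<noteq> 0"
  shows "Re z < 0"
proof (rule ccontr)
  assume "\<not> Re z < 0"
  then have Re: "0 \<le> Re z" by simp
  define S S' where "S = 1 + z *\<^sub>C P" and "S' = 1 + cnj z *\<^sub>C P"
  obtain C where C: "\<And>j. norm (z *\<^sub>C P * S ^ j) \<le> C / real (j + 1) powr (1 / 2)"
    using T unfolding T_set_iff S_def by blast
  have "conj_related (z *\<^sub>C P * S ^ j) (cnj z *\<^sub>C P * S' ^ j)" for j
    unfolding S_def S'_def
    by (intro conj_related_mult conj_related_power conj_related_add conj_related_one
        conj_related_positive_scaleC P)
  then have C': "norm (cnj z *\<^sub>C P * S' ^ j) \<le> C / real (j + 1) powr (1 / 2)" for j
    using C norm_conj_related order_trans by blast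
  define V where "V = (2 * Re z) *\<^sub>R P + (cmod z)\<^sup>2 *\<^sub>R (P * P)"
  have V: "positive_real_op ev V"
    using P Re by (simp add: V_def positive_real_op_def positive_vector_add positive_vector_scaleR)
  have SS: "S' * S = 1 + V"
  proof -
    have "S' * S = 1 + (z + cnj z) *\<^sub>C P + (z * cnj z) *\<^sub>C (P * P)"
      by (simp add: S_def S'_def algebra_simps scaleC_scaleC scaleC_add_left scaleC_add_right)
    then show ?thesis
      by (simp add: V_def complex_add_cnj complex_norm_square[symmetric] scaleC_of_real
          flip: of_real_power of_real_mult)
  qed
  have comm: "S' * S = S * S'" "P * S' = S' * P" "P * S = S * P"
    by (simp_all add: S_def S'_def algebra_simps scaleC_scaleC scaleC_add_right)
  have "cop_apply (P * P) u = 0" if u: "positive_vector ev u" for u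
  proof (rule ccontr)
    assume "cop_apply (P * P) u \<noteq> 0"
    then have n: "norm (cop_apply (P * P) u) > 0" by simp
    have le: "real (j + 1) * ((cmod z)\<^sup>2 * norm (cop_apply (P * P) u)) \<le> C\<^sup>2 * norm u" for j
    proof -
      have "(cnj z *\<^sub>C P * S' ^ j) * (z *\<^sub>C P * S ^ j) = (cmod z)\<^sup>2 *\<^sub>R (S' ^ j * S ^ j * (P * P))"
      proof -
        have "P * S' ^ j = S' ^ j * P" "P * S ^ j = S ^ j * P"
          using power_commuting_commutes[OF comm(2)[symmetric], of j]
            power_commuting_commutes[OF comm(3)[symmetric], of j] by simp_all
        then have "(P * S' ^ j) * (P * S ^ j) = S' ^ j * S ^ j * (P * P)"
          by (metis mult.assoc)
        then show ?thesis
          by (simp add: scaleC_scaleC complex_norm_square[symmetric] scaleC_of_real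
              mult.commute[of "cnj z"] flip: of_real_power)
      qed
      also have "S' ^ j * S ^ j = (1 + V) ^ j"
        using power_mult_commuting[OF comm(1)] by (simp add: SS)
      finally have eq: "(cnj z *\<^sub>C P * S' ^ j) * (z *\<^sub>C P * S ^ j) = (cmod z)\<^sup>2 *\<^sub>R ((1 + V) ^ j * (P * P))" .
      have "(cmod z)\<^sup>2 * norm (cop_apply (P * P) u) \<le> (cmod z)\<^sup>2 * norm (cop_apply ((1 + V) ^ j) (cop_apply (P * P) u))"
        using P u by (intro mult_left_mono norm_le_power_one_plus_positive[OF V])
          (auto simp: positive_real_op_def)
      also have "\<dots> = norm (cop_apply ((cnj z *\<^sub>C P * S' ^ j) * (z *\<^sub>C P * S ^ j)) u)"
        unfolding eq by simp
      also have "\<dots> \<le> norm ((cnj z *\<^sub>C P * S' ^ j) * (z *\<^sub>C P * S ^ j)) * norm u"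
        by (rule norm_cop_apply)
      also have "\<dots> \<le> (C / real (j + 1) powr (1 / 2) * (C / real (j + 1) powr (1 / 2))) * norm u"
        by (intro mult_right_mono order_trans[OF norm_mult_ineq] mult_mono C C' norm_ge_zero
            order_trans[OF norm_ge_zero C])
      also have "C / real (j + 1) powr (1 / 2) * (C / real (j + 1) powr (1 / 2)) = C\<^sup>2 / real (j + 1)"
        by (simp add: power2_eq_square flip: powr_add)
      finally show ?thesis by (simp add: field_simps)
    qed
    obtain j where "C\<^sup>2 * norm u < real j * ((cmod z)\<^sup>2 * norm (cop_apply (P * P) u))"
      using ex_less_of_nat_mult[of "(cmod z)\<^sup>2 * norm (cop_apply (P * P) u)"] n z by auto
    also have "\<dots> \<le> real (j + 1) * ((cmod z)\<^sup>2 * norm (cop_apply (P * P) u))"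
      by (intro mult_right_mono) auto
    finally show False using le[of j] by linarith
  qed
  then have "P * P = 0" by (rule cop_eq_0_positive)
  with P2 show False by simp
qed

lemma positive_T_set_half_subset_A_set:
  assumes P: "positive_real_op ev P" and P0: "P \<noteq> 0"
    and inv: "\<And>w. cop_invertible (1 - w *\<^sub>C P)"
    and G: "\<zeta> \<in> G_set P" "\<zeta> \<noteq> 0"
  shows "T_set (1 / 2) P \<subseteq> A_set P"
proof
  fix z assume T: "z \<in> T_set (1 / 2) P"
  obtain M0 where "\<And>t. 0 \<le> t \<Longrightarrow> norm (exp (t *\<^sub>R (\<zeta> *\<^sub>C P))) \<le> M0"
    using G_set_bounded[OF G(1)] by blast
  from positive_quasinilpotent_bounded_direction[OF P P0 inv G(2) this]
  obtain M where M: "\<And>t. 0 \<le> t \<Longrightarrow> norm (exp (t *\<^sub>R ((- 1) *\<^sub>C P))) \<le> M" by blast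
  show "z \<in> A_set P"
  proof (cases "z = 0")
    case True
    have "cop_inverse 1 = (1 :: 'a cop)" by (rule cop_inverse_eq) simp_all
    then show ?thesis using True by (auto simp: A_set_iff)
  next
    case z: False
    \<comment> \<open>Otherwise \<open>exp (- t P) = 1 - t P\<close> would be unbounded.\<close>
    have "P * P \<noteq> 0"
    proof
      assume "P * P = 0"
      then have "((- 1) *\<^sub>C P) * ((- 1) *\<^sub>C P) = 0" by simp
      from square_zero_bounded_semigroup[OF this M] have "norm ((- 1) *\<^sub>C P) = 0" by simp
      with P0 show False by (simp add: norm_scaleC)
    qed
    then have Re: "Re z < 0" by (rule sqrt_decay_imp_Re_negative[OF P _ T z])
    \<comment> \<open>The factor \<open>s\<close> cancels between the modulus and the real part of
      \<open>- 1 / (s z)\<close>, so the bound is uniform in \<open>s\<close>.\<close>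
    have "norm (cop_inverse (1 - s *\<^sub>R (z *\<^sub>C P))) \<le> M * cmod z / (- Re z)" if s: "s \<ge> 1" for s
    proof -
      let ?w = "of_real s * z"
      have ReD: "Re (- 1 / ?w) = (- Re z) / (s * (cmod z)\<^sup>2)"
      proof -
        have "- 1 / ?w = of_real (- 1 / s) * inverse z" by (simp add: divide_inverse)
        then have "Re (- 1 / ?w) = (- 1 / s) * (Re z / (cmod z)\<^sup>2)"
          by (simp add: cmod_power2)
        then show ?thesis by simp
      qed
      have pos: "Re (- 1 / ?w) > 0"
        unfolding ReD using s z Re by (intro divide_pos_pos mult_pos_pos) auto
      have "norm (cop_inverse (1 - ?w *\<^sub>C P)) \<le> cmod (- 1 / ?w) * (M / Re (- 1 / ?w))"
        by (rule resolvent_bound_direction[OF M _ pos inv]) (use s z in auto)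
      also have "\<dots> = M * cmod z / (- Re z)"
        unfolding ReD using s z Re by (simp add: norm_divide norm_mult power2_eq_square field_simps)
      finally show ?thesis by (simp only: scaleR_scaleC)
    qed
    then show ?thesis unfolding A_set_iff by blast
  qed
qed

end

section \<open>Comparison of exponents and the passage between \<open>P\<close> and
  \<open>Q\<close>\<close>

lemma T_set_one_subset_half: "T_set 1 Q \<subseteq> T_set (1 / 2) Q"
proof
  fix z assume "z \<in> T_set 1 Q"
  then obtain C where C: "\<And>j. norm (z *\<^sub>C Q * (1 + z *\<^sub>C Q) ^ j) \<le> C / real (j + 1) powr 1"
    unfolding T_set_iff by blast
  have C0: "0 \<le> C" using order_trans[OF norm_ge_zero C[of 0]] by simp
  have "C / real (j + 1) powr 1 \<le> C / real (j + 1) powr (1 / 2)" for j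
    using C0 by (intro divide_left_mono powr_mono) auto
  then show "z \<in> T_set (1 / 2) Q"
    unfolding T_set_iff using C order_trans by blast
qed

lemma zero_mem_T_set: "0 \<in> T_set \<alpha> Q"
  unfolding T_set_iff by (intro exI[of _ 0]) simp

lemma zero_mem_B_set: "0 \<in> B_set Q"
  unfolding B_set_iff by (intro exI[of _ 1]) simp

theorem theorem6p3:
  fixes ev :: "'a::{complex_banach, perfect_space} \<Rightarrow> 'w \<Rightarrow> complex"
    and Q :: "'a cop"
  assumes "complex_function_space ev"
    and "Q \<noteq> 0"
    and "quasinilpotent Q"
    and "\<exists>z. z \<noteq> 0 \<and> positive_real_op ev (z *\<^sub>C Q)"
    and "G_set Q \<noteq> {0}"
  shows "T_set 1 Q = interior (B_set Q) \<union> {0} \<and>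
         interior (B_set Q) \<union> {0} \<subseteq> B_set Q \<and>
         T_set (1/2) Q \<subseteq> A_set Q"
proof -
  interpret complex_function_space ev by (rule assms(1))
  interpret regular_complex_function_space ev by unfold_locales
  have inv: "cop_invertible (1 - w *\<^sub>C Q)" for w
    by (rule quasinilpotent_invertible[OF assms(3)])
  obtain z0 where z0: "z0 \<noteq> 0" and pos: "positive_real_op ev (z0 *\<^sub>C Q)"
    using assms(4) by blast
  define P where "P = z0 *\<^sub>C Q"
  \<comment> \<open>Division by \<open>z0\<close> turns directions for \<open>Q\<close> into
    directions for \<open>P\<close> in all the sets.\<close>
  have PQ: "(w / z0) *\<^sub>C P = w *\<^sub>C Q" for w
    using z0 by (simp add: P_def scaleC_scaleC)
  have "norm P \<noteq> 0" using z0 assms(2) by (simp add: P_def norm_scaleC)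
  then have P0: "P \<noteq> 0" by auto
  have invP: "cop_invertible (1 - w *\<^sub>C P)" for w
    using inv by (simp add: P_def scaleC_scaleC)
  obtain \<zeta> where \<zeta>: "\<zeta> \<in> G_set Q" "\<zeta> \<noteq> 0"
    using assms(5) G_set_zero[of Q] by auto
  have "\<zeta> / z0 \<in> G_set P"
    using \<zeta> by (simp add: G_set_def PQ)
  then have "T_set (1 / 2) P \<subseteq> A_set P"
    using \<zeta> z0 pos by (intro positive_T_set_half_subset_A_set[OF _ P0 invP, of "\<zeta> / z0"]) (auto simp: P_def)
  then have TA: "T_set (1 / 2) Q \<subseteq> A_set Q"
  proof (intro subsetI)
    fix z assume "T_set (1 / 2) P \<subseteq> A_set P" "z \<in> T_set (1 / 2) Q"
    moreover from this have "z / z0 \<in> T_set (1 / 2) P" by (simp only: T_set_iff PQ)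
    ultimately have "z / z0 \<in> A_set P" by blast
    then show "z \<in> A_set Q" by (simp only: A_set_iff PQ)
  qed
  \<comment> \<open>A Ritt direction lies in \<open>A_set\<close> by the exponent
    \<open>1 / 2\<close> inclusion; this gives power boundedness first at \<open>z\<close> itself,
    then near it.\<close>
  have "z \<in> interior (B_set Q)" if "z \<in> T_set 1 Q" "z \<noteq> 0" for z
  proof -
    have "z \<in> A_set Q" using that T_set_one_subset_half TA by blast
    then have "z \<in> B_set Q" by (rule T_set_A_set_imp_B_set[OF inv that(1)])
    then show ?thesis by (rule T_set_B_set_imp_interior[OF that(1) _ that(2)])
  qed
  then have "T_set 1 Q = interior (B_set Q) \<union> {0}"
    using interior_B_set_subset_T_set[of Q] zero_mem_T_set by blast
  moreover have "interior (B_set Q) \<union> {0} \<subseteq> B_set Q"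
    using interior_subset zero_mem_B_set by blast
  ultimately show ?thesis using TA by blast
qed

end
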